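(* Let $(\alpha,h)\in\mathcal{M}^{rs}$ and let $u_1^*=u_1^*(\alpha,h)$, $u_2^*=u_2^*(\alpha,h)$ be the two maximizers of $u\mapsto \frac{\alpha}{6}u^3+\frac h2 u-\frac12 I(u)$ on $[0,1]$. For all sufficiently small $\varepsilon>0$ there exists a constant $k=k(\varepsilon;\alpha,h)>0$ such that, with $$J(\varepsilon):=(u_1^*-\varepsilon,u_1^*+\varepsilon)\cup(u_2^*-\varepsilon,u_2^*+\varepsilon),$$ for all large enough $n$ it holds $$\mathbb{P}_{n;\alpha,h}\left(\frac{2S_n}{n^2}\in J(\varepsilon)\right)\ge 1-e^{-kn^2}.$$
   Context: Edge-triangle model. For $n\in\mathbb{N}$ let $\mathcal{E}_n$ be the edge set of the complete graph on $n$ labeled vertices (so $|\mathcal{E}_n|=\binom n2$), let $\mathcal{T}_n$ be the set of triples $\{i,j,k\}\subset\mathcal{E}_n$ of edges forming a triangle, and let $\mathcal{A}_n=\{0,1\}^{\mathcal{E}_n}$ (identified with simple graphs on $n$ labeled vertices). For $\alpha,h\in\mathbb{R}$ and $x\in\mathcal{A}_n$ set $\mathcal{H}_{n;\alpha,h}(x)=\frac{\alpha}{n}\sum_{\{i,j,k\}\in\mathcal{T}_n}x_ix_jx_k+h\sum_{i\in\mathcal{E}_n}x_i$. Let $\mathbb{P}_{n;\alpha,h}$ be the probability measure on $\mathcal{A}_n$ with density $e^{\mathcal{H}_{n;\alpha,h}(x)}/Z_{n;\alpha,h}$, $Z_{n;\alpha,h}=\sum_{x\in\mathcal{A}_n}e^{\mathcal{H}_{n;\alpha,h}(x)}$,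 and let $S_n(x)=\sum_{i\in\mathcal{E}_n}x_i$ be the number of edges. Let $I(u)=u\ln u+(1-u)\ln(1-u)$ on $[0,1]$ (with $0\ln 0=0$). For $\alpha>-2$ consider the scalar problem $\sup_{0\le u\le1}\left(\frac\alpha6u^3+\frac h2u-\frac12I(u)\right)$. It is known that it has a unique maximizer except when $(\alpha,h)$ lies on a critical curve $\mathcal{M}^{rs}=\{(\alpha,h):\alpha>\alpha_c,\ h<h_c,\ h=q(\alpha)\}$ ($q$ a continuous, strictly decreasing function), on which there are exactly two maximizers; here $(\alpha_c,h_c)=\left(\frac{27}{8},\ln2-\frac32\right)$. *)

theory Defs
  imports "HOL-Probability.Probability"
begin

definition edges :: "nat \<Rightarrow> nat set set" where
  "edges n = {e. e \<subseteq> {..<n} \<and> card e = 2}"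

text \<open>A triangle is the (unordered) set of its three edges.\<close>

definition triangles :: "nat \<Rightarrow> nat set set set" where
  "triangles n = {{{a, b}, {b, c}, {a, c}} | a b c.
     a < n \<and> b < n \<and> c < n \<and> a \<noteq> b \<and> b \<noteq> c \<and> a \<noteq> c}"

definition configs :: "nat \<Rightarrow> (nat set \<Rightarrow> real) set" where
  "configs n = (edges n \<rightarrow>\<^sub>E {0, 1})"

definition edge_count :: "nat \<Rightarrow> (nat set \<Rightarrow> real) \<Rightarrow> real" where
  "edge_count n x = (\<Sum>i\<in>edges n. x i)"

definition hamiltonian :: "nat \<Rightarrow> real \<Rightarrow> real \<Rightarrow> (nat set \<Rightarrow> real) \<Rightarrow> real" where
  "hamiltonian n \<alpha> h x =
     \<alpha> / real n * (\<Sum>t\<in>triangles n. \<Prod>i\<in>t. x i) + h * (\<Sum>i\<in>edges n. x i)"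

definition partition_fun :: "nat \<Rightarrow> real \<Rightarrow> real \<Rightarrow> real" where
  "partition_fun n \<alpha> h = (\<Sum>x\<in>configs n. exp (hamiltonian n \<alpha> h x))"

definition gibbs :: "nat \<Rightarrow> real \<Rightarrow> real \<Rightarrow> (nat set \<Rightarrow> real) measure" where
  "gibbs n \<alpha> h =
     point_measure (configs n) (\<lambda>x. ennreal (exp (hamiltonian n \<alpha> h x) / partition_fun n \<alpha> h))"

lemma finite_configs: "finite (configs n)"
proof -
  have "finite (edges n)"
    by (rule finite_subset[of _ "Pow {..<n}"]) (auto simp: edges_def)
  then show ?thesis by (auto simp: configs_def intro: finite_PiE)
qed

lemma prob_space_gibbs: "prob_space (gibbs n \<alpha> h)"
proof
  have "configs n \<noteq> {}" by (auto simp: configs_def PiE_eq_empty_iff)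
  then have pos: "partition_fun n \<alpha> h > 0"
    unfolding partition_fun_def by (intro sum_pos finite_configs) auto
  have "(\<Sum>x\<in>configs n. exp (hamiltonian n \<alpha> h x) / partition_fun n \<alpha> h) = 1"
    using pos by (simp add: sum_divide_distrib[symmetric] partition_fun_def)
  then show "emeasure (gibbs n \<alpha> h) (space (gibbs n \<alpha> h)) = 1"
    using pos by (simp add: gibbs_def space_point_measure emeasure_point_measure_finite
        finite_configs sum_ennreal)
qed

text \<open>At the endpoints \<open>u = 0\<close> and \<open>u = 1\<close> the vanishing factors implement \<open>0 ln 0 = 0\<close>.\<close>

definition entropy_fun :: "real \<Rightarrow> real" where
  "entropy_fun u = u * ln u + (1 - u) * ln (1 - u)"

definition scalar_functional :: "real \<Rightarrow> real \<Rightarrow> real \<Rightarrow> real" where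
  "scalar_functional \<alpha> h u = \<alpha> / 6 * u ^ 3 + h / 2 * u - 1 / 2 * entropy_fun u"

definition maximizers :: "real \<Rightarrow> real \<Rightarrow> real set" where
  "maximizers \<alpha> h = {u. is_arg_max (scalar_functional \<alpha> h) (\<lambda>u. u \<in> {0..1}) u}"

definition alpha_c :: real where
  "alpha_c = 27 / 8"

definition h_c :: real where
  "h_c = ln 2 - 3 / 2"

text \<open>
  The function whose graph is the critical curve has no closed form: for \<open>\<alpha> > alpha_c\<close> its value
  is the only \<open>h\<close> at which the maximizer fails to be unique. Its value at other \<open>\<alpha>\<close> is
  irrelevant.
\<close>

definition q_crit :: "real \<Rightarrow> real" where
  "q_crit \<alpha> = (THE h. \<not> (\<exists>!u. u \<in> maximizers \<alpha> h))"

definition M_rs :: "(real \<times> real) set" where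
  "M_rs = {(\<alpha>, h). \<alpha> > alpha_c \<and> h < h_c \<and> h = q_crit \<alpha>}"

definition J_set :: "real \<Rightarrow> real \<Rightarrow> real \<Rightarrow> real set" where
  "J_set u1 u2 \<epsilon> = {u1 - \<epsilon><..<u1 + \<epsilon>} \<union> {u2 - \<epsilon><..<u2 + \<epsilon>}"

end

theory Submission
  imports Defs "HOL-Real_Asymp.Real_Asymp"
begin

text \<open>
  Why the theorem holds. Write \<open>f\<close> for the scalar functional, \<open>M\<close> for its maximum on the unit
  interval, and \<open>X\<close> for the adjacency matrix of a graph on \<open>n\<close> vertices. The Hamiltonian is
  \<open>\<alpha> / (6 n)\<close> times the trace of \<open>X\<^sup>3\<close> plus \<open>h\<close> times the number of edges. The proof is a large
  deviation upper bound for the weight of the graphs whose edge density lies outside the set \<open>J\<close>,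
  against a lower bound \<open>exp (n\<^sup>2 (M - o(1)))\<close> for the partition function.

  The lower bound is the Gibbs variational principle with an Erdos-Renyi graph of edge density
  \<open>u1\<close> as trial measure (\<open>partition_fun_ge\<close>).

  For the upper bound, every graph admits a partition of its vertices, into a number of classes that
  is bounded uniformly in \<open>n\<close>, such that the triangle sum of \<open>X\<close> hardly exceeds that of the matrix
  \<open>D\<close> of block averages of \<open>X\<close> (\<open>exists_saturated_labelling\<close>, \<open>tri_sum_le_block_avg\<close>). This is a weak
  regularity lemma, but tailored to triangles: one refines only by neighbourhoods of single vertices,
  until no such refinement increases the Frobenius norm of \<open>D\<close> noticeably. By Cauchy-Schwarz the
  triangle sum of \<open>D\<close> is at most the cube of its Frobenius norm (\<open>tri_sum_le_Frobenius\<close>). There are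
  only \<open>exp (o(n\<^sup>2))\<close> possible matrices \<open>D\<close>, and at most \<open>exp (- (\<Sum>p. I(D p)) / 2)\<close> graphs have a
  given \<open>D\<close>, because the random graph with edge probabilities \<open>D\<close> produces each of them with at
  least the inverse of that number as probability (\<open>exp_entropy_le_bernoulli_weight\<close>).

  So the exponent per \<open>n\<^sup>2\<close> is at most \<open>\<alpha>/6 s\<^sup>3 + E(h/2 d - I(d)/2)\<close>, where \<open>d\<close> is a uniformly chosen
  entry of \<open>D\<close> and \<open>s\<^sup>2 = E(d\<^sup>2)\<close>. Because of the identity
  \<open>d\<^sup>3 - 3/2 s d\<^sup>2 + 1/2 s\<^sup>3 = 1/2 (d - s)\<^sup>2 (2 d + s)\<close> this equals
  \<open>M - E(M - f(d) + \<alpha>/12 (d - s)\<^sup>2 (2 d + s))\<close>. Since \<open>\<alpha> > 0\<close>, the integrand is nonnegative, and it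
  vanishes only if \<open>d = s\<close> is one of the two maximizers. As \<open>s\<close> is one number, all entries must be
  close to the same maximizer for the integral to be small; a mixture of both maximizers is thereby
  excluded. Hence a mean of \<open>d\<close> outside \<open>J\<close> costs a fixed amount (\<open>mean_field_gap_outside_J\<close>). The
  mean of \<open>d\<close> is the edge density \<open>2 S / n\<^sup>2\<close>, so these graphs have exponentially small probability.
\<close>

section \<open>Stability of the scalar variational problem\<close>

lemma continuous_on_mult_ln: "continuous_on {0..1} (\<lambda>u::real. u * ln u)"
proof -
  have "continuous (at u within {0..1}) (\<lambda>u. u * ln u)" if u: "u \<in> {0..1}" for u :: real
  proof (cases "u = 0")
    case True
    have "((\<lambda>u::real. u * ln u) \<longlongrightarrow> 0) (at_right 0)" by real_asymp
    then have "((\<lambda>u::real. u * ln u) \<longlongrightarrow> 0) (at 0 within {0..1})"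
      by (simp add: at_within_Icc_at_right)
    then show ?thesis using True by (simp add: continuous_within)
  next
    case False
    then show ?thesis using u by (intro continuous_intros) auto
  qed
  then show ?thesis by (simp add: continuous_on_eq_continuous_within)
qed

lemma continuous_on_entropy_fun: "continuous_on {0..1} entropy_fun"
proof -
  have "continuous_on {0..1} (\<lambda>u::real. (1 - u) * ln (1 - u))"
    by (rule continuous_on_compose2[OF continuous_on_mult_ln]) (auto intro!: continuous_intros)
  then show ?thesis unfolding entropy_fun_def[abs_def]
    by (intro continuous_on_add continuous_on_mult_ln)
qed

lemma continuous_on_scalar_functional: "continuous_on {0..1} (scalar_functional \<alpha> h)"
  unfolding scalar_functional_def[abs_def]
  by (intro continuous_intros continuous_on_entropy_fun)

lemma maximizers_iff:
  "u \<in> maximizers \<alpha> h \<longleftrightarrow>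
     u \<in> {0..1} \<and> (\<forall>v\<in>{0..1}. scalar_functional \<alpha> h v \<le> scalar_functional \<alpha> h u)"
  by (auto simp: maximizers_def is_arg_max_linorder)

text \<open>
  The amount by which an entry \<open>u\<close> falls short of the optimal value \<open>M\<close> when the cube \<open>u\<^sup>3\<close> in the
  scalar functional is replaced by \<open>3/2 s u\<^sup>2 - 1/2 s\<^sup>3\<close>, the tangent at \<open>s\<^sup>2\<close> to the convex function
  that maps \<open>u\<^sup>2\<close> to \<open>u\<^sup>3\<close>. The last term is \<open>\<alpha>/6\<close> times the
  distance between the cube and this tangent.
\<close>

definition mean_field_gap :: "real \<Rightarrow> real \<Rightarrow> real \<Rightarrow> real \<Rightarrow> real \<Rightarrow> real" where
  "mean_field_gap \<alpha> h M s u =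
     M - scalar_functional \<alpha> h u + \<alpha> / 12 * ((u - s)\<^sup>2 * (2 * u + s))"

text \<open>
  The gap vanishes only at the points \<open>(w, w)\<close> with \<open>w\<close> a maximizer: there \<open>u\<close> must be a maximizer,
  and \<open>(u - s)\<^sup>2 (2 u + s) = 0\<close> forces \<open>u = s\<close> for nonnegative \<open>u\<close> and \<open>s\<close>. By compactness it is
  bounded below away from these points.
\<close>

lemma mean_field_gap_lower_bound:
  assumes \<alpha>: "\<alpha> > 0" and maxs: "maximizers \<alpha> h = {u1, u2}" and \<eta>: "\<eta> > 0"
  defines "M \<equiv> scalar_functional \<alpha> h u1"
  obtains k where "k > 0"
    and "\<And>s u. s \<in> {0..1} \<Longrightarrow> u \<in> {0..1} \<Longrightarrow>
      k \<le> mean_field_gap \<alpha> h M s u \<or> (\<exists>w\<in>{u1, u2}. \<bar>s - w\<bar> < \<eta> \<and> \<bar>u - w\<bar> < \<eta>)"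
proof -
  define g where "g = (\<lambda>p. mean_field_gap \<alpha> h M (fst p) (snd p))"
  define K where "K = ({0..1::real} \<times> {0..1::real}) \<inter>
    (\<Inter>w\<in>{u1, u2}. {p. \<eta> \<le> \<bar>fst p - w\<bar>} \<union> {p. \<eta> \<le> \<bar>snd p - w\<bar>})"
  have cpt: "compact K"
    unfolding K_def
    by (intro compact_Int_closed compact_Times closed_INT ballI closed_Un closed_Collect_le
        continuous_intros) auto
  have cont: "continuous_on K g"
  proof -
    have "continuous_on K (\<lambda>p. scalar_functional \<alpha> h (snd p))"
      by (rule continuous_on_compose2[OF continuous_on_scalar_functional])
        (auto simp: K_def intro!: continuous_intros)
    then show ?thesis unfolding g_def mean_field_gap_def by (intro continuous_intros)
  qed
  have pos: "g p > 0" if p: "p \<in> K" for p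
  proof -
    obtain s u where su: "p = (s, u)" by force
    have s: "s \<in> {0..1}" and u: "u \<in> {0..1}" using p su by (auto simp: K_def)
    have u1: "u1 \<in> maximizers \<alpha> h" and u2: "u2 \<in> maximizers \<alpha> h" using maxs by auto
    have le: "scalar_functional \<alpha> h u \<le> M"
      using u1 u unfolding maximizers_iff M_def by auto
    have nn: "0 \<le> (u - s)\<^sup>2 * (2 * u + s)" using s u by (intro mult_nonneg_nonneg) auto
    have "\<not> (scalar_functional \<alpha> h u = M \<and> (u - s)\<^sup>2 * (2 * u + s) = 0)"
    proof
      assume *: "scalar_functional \<alpha> h u = M \<and> (u - s)\<^sup>2 * (2 * u + s) = 0"
      have "u \<in> maximizers \<alpha> h" using * u1 u by (auto simp: maximizers_iff M_def)
      then have "u \<in> {u1, u2}" using maxs by simp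
      moreover have "u = s" using * s u by auto
      ultimately show False using p su \<eta> by (auto simp: K_def)
    qed
    then have "scalar_functional \<alpha> h u < M \<or> 0 < (u - s)\<^sup>2 * (2 * u + s)" using le nn by force
    then show ?thesis using le nn \<alpha> su
      by (auto simp: g_def mean_field_gap_def intro: add_pos_nonneg add_nonneg_pos)
  qed
  show thesis
  proof (cases "K = {}")
    case True
    then show ?thesis by (intro that[of 1]) (fastforce simp: K_def)+
  next
    case False
    obtain p0 where p0: "p0 \<in> K" "\<forall>p\<in>K. g p0 \<le> g p"
      using continuous_attains_inf[OF cpt False cont] by auto
    show ?thesis
    proof (rule that[of "g p0"])
      show "g p0 > 0" using pos p0 by auto
      fix s u :: real assume "s \<in> {0..1}" "u \<in> {0..1}"
      then show "g p0 \<le> mean_field_gap \<alpha> h M s u \<or>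
          (\<exists>w\<in>{u1, u2}. \<bar>s - w\<bar> < \<eta> \<and> \<bar>u - w\<bar> < \<eta>)"
        using p0(2)[rule_format, of "(s, u)"] by (fastforce simp: K_def g_def)
    qed
  qed
qed

text \<open>
  The tangent is exact on average: the terms that are linear in \<open>(d p)\<^sup>2 - s\<^sup>2\<close> sum to zero by the
  choice of \<open>s\<close>. The left side is the mean-field value of the densities \<open>d\<close>, with the triangle
  density replaced by its bound \<open>s\<^sup>3\<close>.
\<close>

lemma mean_field_value_eq:
  fixes d :: "'a \<Rightarrow> real"
  assumes P: "finite P" "P \<noteq> {}"
  defines "N \<equiv> real (card P)"
  defines "s \<equiv> sqrt ((\<Sum>p\<in>P. (d p)\<^sup>2) / N)"
  shows "\<alpha> / 6 * s ^ 3 + (\<Sum>p\<in>P. h / 2 * d p - entropy_fun (d p) / 2) / N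
    = M - (\<Sum>p\<in>P. mean_field_gap \<alpha> h M s (d p)) / N"
proof -
  have N: "N > 0" using P by (simp add: N_def card_gt_0_iff)
  have s2: "N * s\<^sup>2 = (\<Sum>p\<in>P. (d p)\<^sup>2)"
    unfolding s_def using N by (simp add: sum_nonneg)
  have pt: "mean_field_gap \<alpha> h M s u =
      M - (h / 2 * u - entropy_fun u / 2) - \<alpha> / 4 * s * u\<^sup>2 + \<alpha> / 12 * s ^ 3" for u
    unfolding mean_field_gap_def scalar_functional_def
    by (simp add: power2_eq_square power3_eq_cube field_simps)
  have "(\<Sum>p\<in>P. mean_field_gap \<alpha> h M s (d p)) =
      N * M - (\<Sum>p\<in>P. h / 2 * d p - entropy_fun (d p) / 2) - \<alpha> / 4 * s * (\<Sum>p\<in>P. (d p)\<^sup>2)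
        + N * (\<alpha> / 12 * s ^ 3)"
    unfolding pt by (simp add: sum.distrib sum_subtractf sum_distrib_left N_def)
  also have "\<dots> = N * M - (\<Sum>p\<in>P. h / 2 * d p - entropy_fun (d p) / 2) - N * (\<alpha> / 6 * s ^ 3)"
    unfolding s2[symmetric] by (simp add: power2_eq_square power3_eq_cube field_simps)
  finally show ?thesis using N by (simp add: diff_divide_distrib)
qed

text \<open>
  Two cases. If \<open>s\<close> is far from both maximizers, every entry has a gap of at least \<open>k\<close>. If \<open>s\<close> is
  close to the maximizer \<open>w\<close>, an entry either is close to the same \<open>w\<close> or has a gap of at least \<open>k\<close>;
  so a mean at distance at least \<open>\<epsilon>\<close> from \<open>w\<close> needs a proportion of at least \<open>\<epsilon> / 2\<close> of
  entries of the second kind.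
\<close>

proposition mean_field_gap_outside_J:
  assumes \<alpha>: "\<alpha> > 0" and maxs: "maximizers \<alpha> h = {u1, u2}" and ne: "u1 \<noteq> u2" and \<epsilon>: "\<epsilon> > 0"
  shows "\<exists>k>0. \<forall>(P :: 'a set) d. finite P \<longrightarrow> P \<noteq> {} \<longrightarrow> (\<forall>p\<in>P. d p \<in> {0..1}) \<longrightarrow>
    (\<Sum>p\<in>P. d p) / real (card P) \<notin> J_set u1 u2 \<epsilon> \<longrightarrow>
    \<alpha> / 6 * sqrt ((\<Sum>p\<in>P. (d p)\<^sup>2) / real (card P)) ^ 3
      + (\<Sum>p\<in>P. h / 2 * d p - entropy_fun (d p) / 2) / real (card P)
    \<le> scalar_functional \<alpha> h u1 - k"
proof -
  define M where "M = scalar_functional \<alpha> h u1"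
  \<comment> \<open>\<open>\<eta>\<close> is at most half the distance of the maximizers, so that \<open>s\<close> is close to at most one of them.\<close>
  define \<eta> where "\<eta> = min (\<epsilon> / 2) (\<bar>u1 - u2\<bar> / 2)"
  have \<eta>: "\<eta> > 0" "\<eta> \<le> \<epsilon> / 2" "\<eta> \<le> \<bar>u1 - u2\<bar> / 2"
    unfolding \<eta>_def using \<epsilon> ne by (simp, intro min.cobounded1, intro min.cobounded2)
  obtain k where k: "k > 0"
    and gap: "\<And>s u. s \<in> {0..1} \<Longrightarrow> u \<in> {0..1} \<Longrightarrow>
      k \<le> mean_field_gap \<alpha> h M s u \<or> (\<exists>w\<in>{u1, u2}. \<bar>s - w\<bar> < \<eta> \<and> \<bar>u - w\<bar> < \<eta>)"
    using mean_field_gap_lower_bound[OF \<alpha> maxs \<eta>(1)] unfolding M_def by metis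
  have gap_nonneg: "0 \<le> mean_field_gap \<alpha> h M s u" if "s \<in> {0..1}" "u \<in> {0..1}" for s u
  proof -
    have "u1 \<in> maximizers \<alpha> h" using maxs by simp
    then have "scalar_functional \<alpha> h u \<le> M" using that by (simp add: maximizers_iff M_def)
    moreover have "0 \<le> (u - s)\<^sup>2 * (2 * u + s)" using that by (intro mult_nonneg_nonneg) auto
    ultimately show ?thesis using \<alpha> by (simp add: mean_field_gap_def)
  qed
  define k' where "k' = k * min 1 (\<epsilon> / 2)"
  have k': "k' > 0" "k' \<le> k" "k' \<le> k * (\<epsilon> / 2)"
    using k \<epsilon> by (auto simp: k'_def min_mult_distrib_left)
  show ?thesis
  proof (intro exI[of _ k'] conjI allI impI)
    show "k' > 0" by (fact k')
    fix P :: "'a set" and d :: "'a \<Rightarrow> real"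
    assume P: "finite P" "P \<noteq> {}" and d: "\<forall>p\<in>P. d p \<in> {0..1}"
      and out: "(\<Sum>p\<in>P. d p) / real (card P) \<notin> J_set u1 u2 \<epsilon>"
    define N where "N = real (card P)"
    define s where "s = sqrt ((\<Sum>p\<in>P. (d p)\<^sup>2) / N)"
    have N: "N > 0" using P by (simp add: N_def card_gt_0_iff)
    have "(\<Sum>p\<in>P. (d p)\<^sup>2) \<le> (\<Sum>p\<in>P. 1)"
      using d by (intro sum_mono) (auto intro: power_le_one)
    then have s: "s \<in> {0..1}" using N by (auto simp: s_def N_def sum_nonneg)
    let ?g = "\<lambda>p. mean_field_gap \<alpha> h M s (d p)"
    have nn: "0 \<le> ?g p" if "p \<in> P" for p using gap_nonneg s d that by blast
    have "k' * N \<le> (\<Sum>p\<in>P. ?g p)"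
    proof (cases "\<exists>w\<in>{u1, u2}. \<bar>s - w\<bar> < \<eta>")
      case False
      then have "k \<le> ?g p" if "p \<in> P" for p using gap[of s "d p"] s d that by blast
      then have "(\<Sum>p\<in>P. k) \<le> (\<Sum>p\<in>P. ?g p)" by (intro sum_mono) auto
      moreover have "k' * N \<le> k * N" using k' N by (intro mult_right_mono) auto
      ultimately show ?thesis by (simp add: N_def mult.commute)
    next
      case True
      then obtain w where w: "w \<in> {u1, u2}" "\<bar>s - w\<bar> < \<eta>" by blast
      have w01: "w \<in> {0..1}" using w maxs maximizers_iff[of w] by blast
      \<comment> \<open>An entry with a gap of at least \<open>k\<close> is charged the trivial distance \<open>1 \<le> ?g p / k\<close>.\<close>
      have dist: "\<bar>d p - w\<bar> \<le> \<epsilon> / 2 + ?g p / k" if p: "p \<in> P" for p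
      proof (cases "k \<le> ?g p")
        case True
        then have "1 \<le> ?g p / k" using k by simp
        moreover have "\<bar>d p - w\<bar> \<le> 1" using d p w01 by (auto simp: abs_le_iff)
        ultimately show ?thesis using \<epsilon> by linarith
      next
        case False
        then obtain w' where w': "w' \<in> {u1, u2}" "\<bar>s - w'\<bar> < \<eta>" "\<bar>d p - w'\<bar> < \<eta>"
          using gap[of s "d p"] s d p by blast
        have "w' = w" using w w' \<eta> by auto
        moreover have "0 \<le> ?g p / k" using nn p k by auto
        ultimately show ?thesis using w' \<eta> by linarith
      qed
      have "\<epsilon> \<le> \<bar>(\<Sum>p\<in>P. d p) / N - w\<bar>"
        using out w by (auto simp: J_set_def N_def)
      then have "\<epsilon> * N \<le> \<bar>(\<Sum>p\<in>P. d p) / N - w\<bar> * N" using N by (intro mult_right_mono) auto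
      also have "\<dots> = \<bar>(\<Sum>p\<in>P. d p) - w * N\<bar>"
        using N abs_mult[of "(\<Sum>p\<in>P. d p) / N - w" N] by (simp add: left_diff_distrib)
      also have "\<dots> = \<bar>\<Sum>p\<in>P. d p - w\<bar>" by (simp add: sum_subtractf N_def mult.commute)
      also have "\<dots> \<le> (\<Sum>p\<in>P. \<bar>d p - w\<bar>)" by (rule sum_abs)
      also have "\<dots> \<le> (\<Sum>p\<in>P. \<epsilon> / 2 + ?g p / k)" by (intro sum_mono dist)
      also have "\<dots> = \<epsilon> / 2 * N + (\<Sum>p\<in>P. ?g p) / k"
        by (simp add: sum.distrib sum_divide_distrib N_def)
      finally have "k * (\<epsilon> / 2) * N \<le> (\<Sum>p\<in>P. ?g p)" using k by (simp add: field_simps)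
      moreover have "k' * N \<le> k * (\<epsilon> / 2) * N" using k' N by (intro mult_right_mono) auto
      ultimately show ?thesis by linarith
    qed
    then have "k' \<le> (\<Sum>p\<in>P. ?g p) / N" using N by (simp add: pos_le_divide_eq)
    then show "\<alpha> / 6 * sqrt ((\<Sum>p\<in>P. (d p)\<^sup>2) / real (card P)) ^ 3
      + (\<Sum>p\<in>P. h / 2 * d p - entropy_fun (d p) / 2) / real (card P)
      \<le> scalar_functional \<alpha> h u1 - k'"
      using mean_field_value_eq[OF P, of \<alpha> d h M] unfolding N_def s_def M_def by linarith
  qed
qed

section \<open>Averages over the cells of a partition\<close>

text \<open>
  The conditional expectation of \<open>X\<close> given the label \<open>\<kappa>\<close>, for the uniform distribution on \<open>P\<close>.
\<close>

definition cell_avg :: "'a set \<Rightarrow> ('a \<Rightarrow> 'b) \<Rightarrow> ('a \<Rightarrow> real) \<Rightarrow> 'a \<Rightarrow> real" where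
  "cell_avg P \<kappa> X p = (\<Sum>q | q \<in> P \<and> \<kappa> q = \<kappa> p. X q) / real (card {q \<in> P. \<kappa> q = \<kappa> p})"

lemma cell_avg_cong: "\<kappa> p = \<kappa> q \<Longrightarrow> cell_avg P \<kappa> X p = cell_avg P \<kappa> X q"
  by (simp add: cell_avg_def)

text \<open>
  The defining property of a conditional expectation. Both sides are sums over pairs of points in a
  common cell, taken in the two possible orders.
\<close>

lemma cell_avg_inner:
  assumes P: "finite P" and G: "\<And>p q. p \<in> P \<Longrightarrow> q \<in> P \<Longrightarrow> \<kappa> p = \<kappa> q \<Longrightarrow> G p = G q"
  shows "(\<Sum>p\<in>P. cell_avg P \<kappa> X p * G p) = (\<Sum>p\<in>P. X p * G p)"
proof -
  let ?c = "\<lambda>p. real (card {q \<in> P. \<kappa> q = \<kappa> p})"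
  have "(\<Sum>p\<in>P. cell_avg P \<kappa> X p * G p) = (\<Sum>p\<in>P. \<Sum>q | q \<in> P \<and> \<kappa> q = \<kappa> p. X q * G q / ?c q)"
  proof (rule sum.cong[OF refl])
    fix p assume p: "p \<in> P"
    have "cell_avg P \<kappa> X p * G p = (\<Sum>q | q \<in> P \<and> \<kappa> q = \<kappa> p. X q * G p / ?c p)"
      by (simp add: cell_avg_def sum_distrib_right sum_divide_distrib)
    also have "\<dots> = (\<Sum>q | q \<in> P \<and> \<kappa> q = \<kappa> p. X q * G q / ?c q)"
    proof (intro sum.cong refl)
      fix q assume q: "q \<in> {q \<in> P. \<kappa> q = \<kappa> p}"
      then have "G p = G q" using G[of p q] p by simp
      then show "X q * G p / ?c p = X q * G q / ?c q" using q by simp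
    qed
    finally show "cell_avg P \<kappa> X p * G p = \<dots>" .
  qed
  also have "\<dots> = (\<Sum>q\<in>P. \<Sum>p | p \<in> P \<and> \<kappa> q = \<kappa> p. X q * G q / ?c q)"
    by (rule sum.swap_restrict[OF P P])
  also have "\<dots> = (\<Sum>q\<in>P. X q * G q)"
  proof (rule sum.cong[OF refl])
    fix q assume q: "q \<in> P"
    have "card {p \<in> P. \<kappa> p = \<kappa> q} > 0" using q P by (auto simp: card_gt_0_iff)
    then show "(\<Sum>p | p \<in> P \<and> \<kappa> q = \<kappa> p. X q * G q / ?c q) = X q * G q"
      by (simp add: eq_commute[of "\<kappa> q"])
  qed
  finally show ?thesis .
qed

lemma cell_avg_sum:
  assumes "finite P" shows "(\<Sum>p\<in>P. cell_avg P \<kappa> X p) = (\<Sum>p\<in>P. X p)"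
  using cell_avg_inner[OF assms, of \<kappa> "\<lambda>_. 1" X] by simp

lemma cell_avg_unit_interval:
  assumes P: "finite P" and X: "\<And>p. p \<in> P \<Longrightarrow> X p \<in> {0..1}"
  shows "cell_avg P \<kappa> X p \<in> {0..1}"
proof -
  let ?C = "{q \<in> P. \<kappa> q = \<kappa> p}"
  have "0 \<le> sum X ?C" using X by (intro sum_nonneg) auto
  moreover have "sum X ?C \<le> (\<Sum>q\<in>?C. 1)" using X by (intro sum_mono) auto
  ultimately show ?thesis
    by (auto simp: cell_avg_def divide_le_eq_1)
qed

lemma cell_avg_eq_0D:
  assumes P: "finite P" and X: "\<And>p. p \<in> P \<Longrightarrow> X p \<in> {0..1}" and p: "p \<in> P"
    and 0: "cell_avg P \<kappa> X p = 0"
  shows "X p = 0"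
proof -
  have "card {q \<in> P. \<kappa> q = \<kappa> p} > 0" using p P by (auto simp: card_gt_0_iff)
  then have "(\<Sum>q | q \<in> P \<and> \<kappa> q = \<kappa> p. X q) = 0" using 0 by (auto simp: cell_avg_def)
  then have "\<forall>q\<in>{q \<in> P. \<kappa> q = \<kappa> p}. X q = 0"
    using P X by (subst (asm) sum_nonneg_eq_0_iff) auto
  then show ?thesis using p by auto
qed

lemma cell_avg_eq_1D:
  assumes P: "finite P" and X: "\<And>p. p \<in> P \<Longrightarrow> X p \<in> {0..1}" and p: "p \<in> P"
    and 1: "cell_avg P \<kappa> X p = 1"
  shows "X p = 1"
proof -
  have "card {q \<in> P. \<kappa> q = \<kappa> p} > 0" using p P by (auto simp: card_gt_0_iff)
  then have "cell_avg P \<kappa> (\<lambda>q. 1 - X q) p = 0"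
    using 1 by (simp add: cell_avg_def sum_subtractf diff_divide_distrib)
  then show ?thesis using cell_avg_eq_0D[of P "\<lambda>q. 1 - X q" p \<kappa>] P X p by force
qed

text \<open>
  By Pythagoras, the energy increment under a refinement is the squared distance of the two
  averages. A test function \<open>G\<close> that is constant on the finer cells sees \<open>X\<close> only through its finer
  average, so Cauchy-Schwarz bounds the effect on \<open>G\<close> of replacing \<open>X\<close> by the coarser average.
\<close>

lemma cell_avg_refine_inner:
  assumes P: "finite P"
    and refines: "\<And>p q. \<kappa>' p = \<kappa>' q \<Longrightarrow> \<kappa> p = \<kappa> q"
    and G: "\<And>p q. p \<in> P \<Longrightarrow> q \<in> P \<Longrightarrow> \<kappa>' p = \<kappa>' q \<Longrightarrow> G p = G q"
    and G1: "\<And>p. p \<in> P \<Longrightarrow> \<bar>G p\<bar> \<le> 1"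
    and \<epsilon>: "\<epsilon> \<ge> 0"
    and energy: "(\<Sum>p\<in>P. (cell_avg P \<kappa>' X p)\<^sup>2) \<le> (\<Sum>p\<in>P. (cell_avg P \<kappa> X p)\<^sup>2) + \<epsilon>\<^sup>2 * real (card P)"
  shows "\<bar>(\<Sum>p\<in>P. X p * G p) - (\<Sum>p\<in>P. cell_avg P \<kappa> X p * G p)\<bar> \<le> \<epsilon> * real (card P)"
proof -
  let ?D = "cell_avg P \<kappa> X" and ?D' = "cell_avg P \<kappa>' X"
  have "(\<Sum>p\<in>P. ?D' p * ?D p) = (\<Sum>p\<in>P. X p * ?D p)"
    using cell_avg_inner[OF P, of \<kappa>' ?D X] by (metis refines cell_avg_cong)
  also have "\<dots> = (\<Sum>p\<in>P. ?D p * ?D p)"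
    using cell_avg_inner[OF P, of \<kappa> ?D X] by (metis cell_avg_cong)
  finally have cross: "(\<Sum>p\<in>P. ?D' p * ?D p) = (\<Sum>p\<in>P. (?D p)\<^sup>2)"
    by (simp add: power2_eq_square)
  have "(\<Sum>p\<in>P. (?D' p - ?D p)\<^sup>2) =
      (\<Sum>p\<in>P. (?D' p)\<^sup>2) + (\<Sum>p\<in>P. (?D p)\<^sup>2) - 2 * (\<Sum>p\<in>P. ?D' p * ?D p)"
    by (simp add: power2_diff sum.distrib sum_subtractf sum_distrib_left mult.assoc)
  then have pyth: "(\<Sum>p\<in>P. (?D' p - ?D p)\<^sup>2) \<le> \<epsilon>\<^sup>2 * real (card P)"
    using energy cross by linarith
  have G2: "(\<Sum>p\<in>P. (G p)\<^sup>2) \<le> card P"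
  proof -
    have "(\<Sum>p\<in>P. (G p)\<^sup>2) \<le> (\<Sum>p\<in>P. 1)"
      using G1 by (intro sum_mono) (simp add: abs_square_le_1)
    then show ?thesis by simp
  qed
  have "(\<Sum>p\<in>P. ?D' p * G p) = (\<Sum>p\<in>P. X p * G p)"
    by (rule cell_avg_inner[OF P]) (fact G)
  then have "(\<Sum>p\<in>P. X p * G p) - (\<Sum>p\<in>P. ?D p * G p) = (\<Sum>p\<in>P. (?D' p - ?D p) * G p)"
    by (simp add: left_diff_distrib sum_subtractf)
  moreover have "(\<Sum>p\<in>P. (?D' p - ?D p) * G p)\<^sup>2 \<le> (\<epsilon> * real (card P))\<^sup>2"
  proof -
    have "(\<Sum>p\<in>P. (?D' p - ?D p) * G p)\<^sup>2 \<le> (\<Sum>p\<in>P. (?D' p - ?D p)\<^sup>2) * (\<Sum>p\<in>P. (G p)\<^sup>2)"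
      by (rule Cauchy_Schwarz_ineq_sum)
    also have "\<dots> \<le> (\<epsilon>\<^sup>2 * real (card P)) * real (card P)"
      by (intro mult_mono pyth G2 sum_nonneg) auto
    finally show ?thesis by (simp add: power2_eq_square mult_ac)
  qed
  ultimately show ?thesis using \<epsilon> by (simp add: abs_le_square_iff[symmetric])
qed

lemma cell_avg_comp:
  assumes P: "finite P" and \<sigma>: "\<sigma> ` P = P" "inj_on \<sigma> P" and p: "p \<in> P"
    and \<kappa>: "\<And>q. q \<in> P \<Longrightarrow> \<kappa> (\<sigma> q) = \<kappa> (\<sigma> p) \<longleftrightarrow> \<kappa> q = \<kappa> p"
    and X: "\<And>q. q \<in> P \<Longrightarrow> X (\<sigma> q) = X q"
  shows "cell_avg P \<kappa> X (\<sigma> p) = cell_avg P \<kappa> X p"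
proof -
  let ?C = "{q \<in> P. \<kappa> q = \<kappa> p}"
  have "{q \<in> P. \<kappa> q = \<kappa> (\<sigma> p)} = {q \<in> \<sigma> ` P. \<kappa> q = \<kappa> (\<sigma> p)}"
    by (simp only: \<sigma>(1))
  also have "\<dots> = \<sigma> ` {q \<in> P. \<kappa> (\<sigma> q) = \<kappa> (\<sigma> p)}" by blast
  also have "\<dots> = \<sigma> ` ?C" using \<kappa> by (intro arg_cong[of _ _ "image \<sigma>"] Collect_cong) auto
  finally have cell: "{q \<in> P. \<kappa> q = \<kappa> (\<sigma> p)} = \<sigma> ` ?C" .
  have inj: "inj_on \<sigma> ?C" using \<sigma>(2) by (rule inj_on_subset) auto
  show ?thesis
    unfolding cell_avg_def cell using X by (simp add: sum.reindex[OF inj] card_image[OF inj])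
qed

section \<open>Triangle sums of block averages\<close>

text \<open>
  The trace of \<open>A B C\<^sup>T\<close>, with three arguments so that the sides of the triangles can be replaced one
  at a time.
\<close>

definition tri_sum :: "nat \<Rightarrow> (nat \<times> nat \<Rightarrow> real) \<Rightarrow> (nat \<times> nat \<Rightarrow> real) \<Rightarrow> (nat \<times> nat \<Rightarrow> real) \<Rightarrow> real" where
  "tri_sum n A B C = (\<Sum>a<n. \<Sum>b<n. \<Sum>c<n. A (a, b) * B (b, c) * C (a, c))"

abbreviation vpairs :: "nat \<Rightarrow> (nat \<times> nat) set" where
  "vpairs n \<equiv> {..<n} \<times> {..<n}"

lemma sum_vpairs: "(\<Sum>p\<in>vpairs n. f p) = (\<Sum>a<n. \<Sum>b<n. f (a, b))"
  by (simp add: sum.cartesian_product)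

text \<open>
  Each side of the triangle can be singled out; the third vertex \<open>k\<close> then acts as a parameter.
\<close>

lemma tri_sum_sides:
  "tri_sum n A B C = (\<Sum>k<n. \<Sum>p\<in>vpairs n. A p * (B (snd p, k) * C (fst p, k)))"
  "tri_sum n A B C = (\<Sum>k<n. \<Sum>p\<in>vpairs n. B p * (A (k, fst p) * C (k, snd p)))"
  "tri_sum n A B C = (\<Sum>k<n. \<Sum>p\<in>vpairs n. C p * (A (fst p, k) * B (k, snd p)))"
proof -
  have "tri_sum n A B C = (\<Sum>a<n. \<Sum>c<n. \<Sum>b<n. A (a, b) * B (b, c) * C (a, c))"
    unfolding tri_sum_def by (intro sum.cong refl sum.swap)
  also have "\<dots> = (\<Sum>c<n. \<Sum>a<n. \<Sum>b<n. A (a, b) * B (b, c) * C (a, c))" by (rule sum.swap)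
  finally show "tri_sum n A B C = (\<Sum>k<n. \<Sum>p\<in>vpairs n. A p * (B (snd p, k) * C (fst p, k)))"
    by (simp add: sum_vpairs mult.assoc)
  show "tri_sum n A B C = (\<Sum>k<n. \<Sum>p\<in>vpairs n. B p * (A (k, fst p) * C (k, snd p)))"
    unfolding tri_sum_def sum_vpairs by (intro sum.cong refl) simp
  have "tri_sum n A B C = (\<Sum>b<n. \<Sum>a<n. \<Sum>c<n. A (a, b) * B (b, c) * C (a, c))"
    unfolding tri_sum_def by (rule sum.swap)
  then show "tri_sum n A B C = (\<Sum>k<n. \<Sum>p\<in>vpairs n. C p * (A (fst p, k) * B (k, snd p)))"
    by (simp add: sum_vpairs mult.commute)
qed

abbreviation pair_label :: "(nat \<Rightarrow> nat) \<Rightarrow> nat \<times> nat \<Rightarrow> nat \<times> nat" where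
  "pair_label c \<equiv> map_prod c c"

abbreviation block_avg :: "nat \<Rightarrow> (nat \<Rightarrow> nat) \<Rightarrow> (nat \<times> nat \<Rightarrow> real) \<Rightarrow> nat \<times> nat \<Rightarrow> real" where
  "block_avg n c \<equiv> cell_avg (vpairs n) (pair_label c)"

definition energy :: "nat \<Rightarrow> (nat \<Rightarrow> nat) \<Rightarrow> (nat \<times> nat \<Rightarrow> real) \<Rightarrow> real" where
  "energy n c X = (\<Sum>p\<in>vpairs n. (block_avg n c X p)\<^sup>2)"

text \<open>
  The common refinement of a vertex partition with the neighbourhood of \<open>k\<close> and its complement. The
  class index is doubled so that labels below \<open>2 ^ j\<close> become labels below \<open>2 ^ Suc j\<close>.
\<close>

definition refine_by :: "(nat \<times> nat \<Rightarrow> real) \<Rightarrow> nat \<Rightarrow> (nat \<Rightarrow> nat) \<Rightarrow> nat \<Rightarrow> nat" where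
  "refine_by X k c i = 2 * c i + (if X (k, i) = 1 then 1 else 0)"

lemma refine_by_eqD:
  assumes "refine_by X k c i = refine_by X k c j"
  shows "c i = c j" "X (k, i) = 1 \<longleftrightarrow> X (k, j) = 1"
  using assms unfolding refine_by_def by (auto split: if_splits; presburger)+

text \<open>
  Energy increment: start with one class and refine by a neighbourhood as long as that raises the
  energy by more than \<open>\<epsilon>\<^sup>2 n\<^sup>2\<close>. The energy never exceeds \<open>n\<^sup>2\<close>, so this stops after fewer than \<open>N\<close>
  steps. The number of classes is bounded uniformly in \<open>n\<close>.
\<close>

lemma exists_saturated_labelling:
  assumes X: "\<And>p. p \<in> vpairs n \<Longrightarrow> X p \<in> {0, 1}" and \<epsilon>: "\<epsilon> > 0" and N: "real N * \<epsilon>\<^sup>2 > 1" and n: "n > 0"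
  shows "\<exists>c. (\<forall>i. c i < 2 ^ N) \<and>
    (\<forall>k<n. energy n (refine_by X k c) X \<le> energy n c X + \<epsilon>\<^sup>2 * real (card (vpairs n)))"
proof (rule ccontr)
  assume contra: "\<not> ?thesis"
  have "\<exists>c. (\<forall>i. c i < 2 ^ j) \<and> real j * (\<epsilon>\<^sup>2 * real (card (vpairs n))) \<le> energy n c X" if "j \<le> N" for j
    using that
  proof (induction j)
    case 0
    show ?case by (intro exI[of _ "\<lambda>_. 0"]) (simp add: energy_def sum_nonneg)
  next
    case (Suc j)
    then obtain c where c: "\<And>i. c i < 2 ^ j" "real j * (\<epsilon>\<^sup>2 * real (card (vpairs n))) \<le> energy n c X"
      by auto
    have "c i < 2 ^ N" for i
      using Suc.prems by (intro order.strict_trans2[OF c(1) power_increasing]) auto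
    then obtain k where k: "energy n c X + \<epsilon>\<^sup>2 * real (card (vpairs n)) < energy n (refine_by X k c) X"
      using contra by (metis not_le)
    have "refine_by X k c i < 2 ^ Suc j" for i
      using c(1)[of i] by (auto simp: refine_by_def)
    moreover have "real (Suc j) * (\<epsilon>\<^sup>2 * real (card (vpairs n))) \<le> energy n (refine_by X k c) X"
      using k c(2) by (simp add: distrib_right)
    ultimately show ?case by blast
  qed
  then obtain c where "real N * (\<epsilon>\<^sup>2 * real (card (vpairs n))) \<le> energy n c X" by auto
  also have "\<dots> \<le> (\<Sum>p\<in>vpairs n. 1)"
  proof -
    have "X p \<in> {0..1}" if "p \<in> vpairs n" for p using X[OF that] by auto
    then have "block_avg n c X p \<in> {0..1}" for p by (intro cell_avg_unit_interval) simp_all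
    then show ?thesis unfolding energy_def
      by (intro sum_mono power_le_one) auto
  qed
  finally have "(real N * \<epsilon>\<^sup>2) * real (card (vpairs n)) \<le> 1 * real (card (vpairs n))" by (simp add: mult_ac)
  then show False using N n by (simp add: mult_le_cancel_right)
qed

text \<open>
  The three sides of the triangle are replaced one after the other. For a fixed third vertex \<open>k\<close>,
  the product of the other two sides is constant on the blocks of the partition refined by the
  neighbourhood of \<open>k\<close>, in the first replacement because both sides are rows of \<open>X\<close>, in the second
  because one is a row of \<open>X\<close> and the other a row of \<open>D\<close>. So a single refinement step always
  suffices, and saturation bounds each error by \<open>\<epsilon> n\<^sup>2\<close> for every \<open>k\<close>. In the third replacement both
  remaining sides are rows or columns of \<open>D\<close>, and there is no error.
\<close>

lemma tri_sum_le_block_avg: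
  assumes X: "\<And>p. p \<in> vpairs n \<Longrightarrow> X p \<in> {0, 1}" and sym: "\<And>i j. X (i, j) = X (j, i)" and \<epsilon>: "\<epsilon> > 0"
    and sat: "\<And>k. k < n \<Longrightarrow>
      energy n (refine_by X k c) X \<le> energy n c X + \<epsilon>\<^sup>2 * real (card (vpairs n))"
  defines "D \<equiv> block_avg n c X"
  shows "tri_sum n X X X \<le> tri_sum n D D D + 2 * \<epsilon> * real n ^ 3"
proof -
  have X01: "0 \<le> X p" "X p \<le> 1" "\<bar>X p\<bar> \<le> 1" if "p \<in> vpairs n" for p using X[OF that] by auto
  have D01: "0 \<le> D p" "D p \<le> 1" for p
    using cell_avg_unit_interval[of "vpairs n" X "pair_label c" p] X01 by (auto simp: D_def)
  have D_cong: "D (i, j) = D (i', j')" if "c i = c i'" "c j = c j'" for i j i' j'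
    unfolding D_def by (rule cell_avg_cong) (simp add: that)
  have cut: "(\<Sum>p\<in>vpairs n. X p * G p - D p * G p) \<le> \<epsilon> * real n ^ 2"
    if k: "k < n" and G1: "\<And>p. p \<in> vpairs n \<Longrightarrow> \<bar>G p\<bar> \<le> 1"
      and G: "\<And>i j i' j'. c i = c i' \<Longrightarrow> c j = c j' \<Longrightarrow> X (k, i) = X (k, i') \<Longrightarrow>
        X (k, j) = X (k, j') \<Longrightarrow> G (i, j) = G (i', j')" for k G
  proof -
    let ?c' = "refine_by X k c"
    have *: "c i = c j \<and> X (k, i) = X (k, j)" if "?c' i = ?c' j" "i < n" "j < n" for i j
      using refine_by_eqD[OF that(1)] k that(2,3) X[of "(k, i)"] X[of "(k, j)"] by fastforce
    have "\<bar>(\<Sum>p\<in>vpairs n. X p * G p) - (\<Sum>p\<in>vpairs n. D p * G p)\<bar> \<le> \<epsilon> * real (card (vpairs n))"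
      unfolding D_def
    proof (rule cell_avg_refine_inner[where \<kappa>' = "pair_label ?c'"])
      fix p q :: "nat \<times> nat"
      assume "pair_label ?c' p = pair_label ?c' q"
      then have pq: "?c' (fst p) = ?c' (fst q)" "?c' (snd p) = ?c' (snd q)"
        by (simp_all add: prod_eq_iff)
      show "pair_label c p = pair_label c q"
        using refine_by_eqD(1)[OF pq(1)] refine_by_eqD(1)[OF pq(2)] by (simp add: prod_eq_iff)
      assume "p \<in> vpairs n" "q \<in> vpairs n"
      then show "G p = G q"
        using G[of "fst p" "fst q" "snd p" "snd q"] *[OF pq(1)] *[OF pq(2)] by (simp add: mem_Times_iff)
    next
      show "(\<Sum>p\<in>vpairs n. (block_avg n ?c' X p)\<^sup>2)
          \<le> (\<Sum>p\<in>vpairs n. (block_avg n c X p)\<^sup>2) + \<epsilon>\<^sup>2 * real (card (vpairs n))"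
        using sat[OF k] by (simp add: energy_def)
    qed (use G1 \<epsilon> in simp_all)
    then show ?thesis by (simp add: sum_subtractf power2_eq_square)
  qed
  have first_side: "tri_sum n A X X = (\<Sum>k<n. \<Sum>p\<in>vpairs n. A p * (X (k, snd p) * X (k, fst p)))" for A
    unfolding tri_sum_sides(1) by (intro sum.cong refl arg_cong2[of _ _ _ _ "(*)"] sym)
  have "tri_sum n X X X - tri_sum n D X X \<le> (\<Sum>k<n. \<epsilon> * real n ^ 2)"
    unfolding first_side sum_subtractf[symmetric]
  proof (intro sum_mono)
    fix k assume "k \<in> {..<n}"
    then show "(\<Sum>p\<in>vpairs n. X p * (X (k, snd p) * X (k, fst p))
        - D p * (X (k, snd p) * X (k, fst p))) \<le> \<epsilon> * real n ^ 2"
      by (intro cut[of k]) (auto simp: abs_mult intro!: mult_le_one X01)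
  qed
  moreover have "tri_sum n D X X - tri_sum n D D X \<le> (\<Sum>k<n. \<epsilon> * real n ^ 2)"
    unfolding tri_sum_sides(2) sum_subtractf[symmetric]
  proof (intro sum_mono)
    fix k assume "k \<in> {..<n}"
    then show "(\<Sum>p\<in>vpairs n. X p * (D (k, fst p) * X (k, snd p))
        - D p * (D (k, fst p) * X (k, snd p))) \<le> \<epsilon> * real n ^ 2"
    proof (intro cut[of k])
      fix i j i' j' assume "c i = c i'" "X (k, j) = X (k, j')"
      then show "D (k, fst (i, j)) * X (k, snd (i, j)) = D (k, fst (i', j')) * X (k, snd (i', j'))"
        using D_cong[of k k i i'] by simp
    qed (auto simp: abs_mult D01 intro!: mult_le_one X01)
  qed
  moreover have "tri_sum n D D X = tri_sum n D D D"
    unfolding tri_sum_sides(3) D_def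
  proof (rule sum.cong[OF refl], rule cell_avg_inner[symmetric])
    fix k and p q :: "nat \<times> nat"
    assume "pair_label c p = pair_label c q"
    then have "c (fst p) = c (fst q)" "c (snd p) = c (snd q)" by (simp_all add: prod_eq_iff)
    then show "block_avg n c X (fst p, k) * block_avg n c X (k, snd p) =
        block_avg n c X (fst q, k) * block_avg n c X (k, snd q)"
      using D_cong[of "fst p" "fst q" k k] D_cong[of k k "snd p" "snd q"] by (simp add: D_def)
  qed simp
  ultimately show ?thesis by (simp add: power2_eq_square power3_eq_cube algebra_simps)
qed

text \<open>
  Cauchy-Schwarz between \<open>D\<close> and its matrix square, whose Frobenius norm is at most the square of
  that of \<open>D\<close>.
\<close>

lemma tri_sum_le_Frobenius:
  "tri_sum n D D D \<le> sqrt (\<Sum>p\<in>vpairs n. (D p)\<^sup>2) ^ 3"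
proof -
  define S where "S = (\<Sum>p\<in>vpairs n. (D p)\<^sup>2)"
  define H where "H = (\<lambda>p. \<Sum>b<n. D (fst p, b) * D (b, snd p))"
  have S: "S \<ge> 0" unfolding S_def by (intro sum_nonneg) auto
  have "(\<Sum>p\<in>vpairs n. (H p)\<^sup>2) \<le>
      (\<Sum>p\<in>vpairs n. (\<Sum>b<n. (D (fst p, b))\<^sup>2) * (\<Sum>b<n. (D (b, snd p))\<^sup>2))"
    unfolding H_def by (intro sum_mono Cauchy_Schwarz_ineq_sum)
  also have "\<dots> = (\<Sum>a<n. \<Sum>b<n. (D (a, b))\<^sup>2) * (\<Sum>c<n. \<Sum>b<n. (D (b, c))\<^sup>2)"
    by (simp add: sum_vpairs sum_product)
  also have "(\<Sum>c<n. \<Sum>b<n. (D (b, c))\<^sup>2) = (\<Sum>b<n. \<Sum>c<n. (D (b, c))\<^sup>2)"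
    by (rule sum.swap)
  finally have H: "(\<Sum>p\<in>vpairs n. (H p)\<^sup>2) \<le> S\<^sup>2"
    by (simp add: S_def sum_vpairs power2_eq_square)
  have "tri_sum n D D D = (\<Sum>p\<in>vpairs n. D p * H p)"
    unfolding tri_sum_sides(3) H_def by (subst sum.swap) (simp only: sum_distrib_left)
  also have "\<dots> \<le> sqrt ((\<Sum>p\<in>vpairs n. D p * H p)\<^sup>2)" by simp
  also have "\<dots> \<le> sqrt (S * S\<^sup>2)"
    by (intro real_sqrt_le_mono order_trans[OF Cauchy_Schwarz_ineq_sum[of D H "vpairs n", folded S_def]
        mult_left_mono[OF H S]])
  also have "\<dots> = sqrt S ^ 3"
    using S by (simp add: real_sqrt_mult power3_eq_cube)
  finally show ?thesis by (simp add: S_def)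
qed

section \<open>Edges and triangles as sums over matrices\<close>

text \<open>
  The symmetric matrix with zero diagonal of a function on edges, for a graph its adjacency matrix.
\<close>

definition adj :: "(nat set \<Rightarrow> real) \<Rightarrow> nat \<times> nat \<Rightarrow> real" where
  "adj x p = (if fst p = snd p then 0 else x {fst p, snd p})"

lemma adj_sym: "adj x (i, j) = adj x (j, i)"
  by (simp add: adj_def insert_commute)

lemma finite_edges: "finite (edges n)"
  by (rule finite_subset[of _ "Pow {..<n}"]) (auto simp: edges_def)

lemma edge_in_edges: "i < n \<Longrightarrow> j < n \<Longrightarrow> i \<noteq> j \<Longrightarrow> {i, j} \<in> edges n"
  by (auto simp: edges_def card_2_iff)

lemma edgesE:
  assumes "e \<in> edges n"
  obtains i j where "e = {i, j}" "i < j" "j < n" "Min e = i" "Max e = j"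
proof -
  obtain i j where e: "e = {i, j}" "i \<noteq> j" "i < n" "j < n"
    using assms by (auto simp: edges_def card_2_iff)
  show thesis
  proof (cases "i < j")
    case True then show ?thesis using e by (intro that[of i j]) auto
  next
    case False then show ?thesis using e by (intro that[of j i]) auto
  qed
qed

lemma sum_adj: "(\<Sum>p\<in>vpairs n. adj f p) = 2 * (\<Sum>e\<in>edges n. f e)"
proof -
  define D where "D = {p \<in> vpairs n. fst p \<noteq> snd p}"
  define \<phi> where "\<phi> = (\<lambda>p :: nat \<times> nat. {fst p, snd p})"
  have fin: "finite D" unfolding D_def by simp
  have im: "\<phi> ` D \<subseteq> edges n" by (auto simp: D_def \<phi>_def intro: edge_in_edges)
  have "card {p \<in> D. \<phi> p = e} = 2" if e: "e \<in> edges n" for e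
  proof -
    obtain i j where ij: "e = {i, j}" "i < j" "j < n" using e by (rule edgesE)
    have "{p \<in> D. \<phi> p = e} = {(i, j), (j, i)}"
      using ij by (auto simp: D_def \<phi>_def doubleton_eq_iff)
    then show ?thesis using ij by (simp add: card_2_iff)
  qed
  then have "(\<Sum>p\<in>D. f (\<phi> p)) = (\<Sum>e\<in>edges n. 2 * f e)"
    by (subst sum_fun_comp[OF fin finite_edges im]) simp
  moreover have "(\<Sum>p\<in>vpairs n. adj f p) = (\<Sum>p\<in>D. f (\<phi> p))"
    by (rule sum.mono_neutral_cong_right) (auto simp: D_def adj_def \<phi>_def)
  ultimately show ?thesis by (simp add: sum_distrib_left)
qed

lemma finite_triangles: "finite (triangles n)"
proof (rule finite_subset)
  show "triangles n \<subseteq> Pow (edges n)"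
    by (auto simp: triangles_def intro!: edge_in_edges)
qed (simp add: finite_edges)

lemma triangle_edges:
  assumes "t \<in> triangles n" shows "t \<subseteq> edges n" "card t = 3"
  using assms by (auto simp: triangles_def card_insert_if doubleton_eq_iff intro!: edge_in_edges)

text \<open>
  Each triangle arises from the six orderings of its vertices, and triples with a repeated vertex do
  not contribute because the diagonal of the matrix is zero.
\<close>

lemma sum_triangles: "6 * (\<Sum>t\<in>triangles n. \<Prod>i\<in>t. x i) = tri_sum n (adj x) (adj x) (adj x)"
proof -
  define V where "V = {..<n} \<times> {..<n} \<times> {..<n}"
  define D where "D = {(a, b, c). a < n \<and> b < n \<and> c < n \<and> a \<noteq> b \<and> b \<noteq> c \<and> a \<noteq> c}"
  define \<phi> where "\<phi> = (\<lambda>(a::nat, b, c). {{a, b}, {b, c}, {a, c}})"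
  have DV: "D \<subseteq> V" by (auto simp: D_def V_def)
  have finV: "finite V" by (simp add: V_def)
  have fin: "finite D" using DV finV by (rule finite_subset)
  have im: "\<phi> ` D \<subseteq> triangles n" by (auto simp: D_def \<phi>_def triangles_def)
  have "card {p \<in> D. \<phi> p = t} = 6" if t_in: "t \<in> triangles n" for t
  proof -
    obtain a b c where abc: "a < n" "b < n" "c < n" "a \<noteq> b" "b \<noteq> c" "a \<noteq> c"
      and t: "t = {{a, b}, {b, c}, {a, c}}" using t_in unfolding triangles_def by blast
    let ?F = "{(a, b, c), (a, c, b), (b, a, c), (b, c, a), (c, a, b), (c, b, a)}"
    have "{p \<in> D. \<phi> p = t} = ?F"
    proof (intro equalityI subsetI)
      fix p assume p: "p \<in> {p \<in> D. \<phi> p = t}"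
      obtain a' b' c' where p': "p = (a', b', c')" by (cases p) auto
      have "\<Union>(\<phi> p) = \<Union>t" using p by simp
      then have "{a', b', c'} = {a, b, c}" unfolding p' \<phi>_def t by auto
      then have "a' \<in> {a, b, c}" "b' \<in> {a, b, c}" "c' \<in> {a, b, c}" by (metis insertI1 insertI2)+
      moreover have "a' \<noteq> b'" "b' \<noteq> c'" "a' \<noteq> c'" using p p' by (auto simp: D_def)
      ultimately show "p \<in> ?F" unfolding p' by auto
    next
      fix p assume "p \<in> ?F"
      then show "p \<in> {p \<in> D. \<phi> p = t}"
        using abc by (auto simp: D_def \<phi>_def t insert_commute)
    qed
    then show ?thesis using abc by simp
  qed
  then have "(\<Sum>p\<in>D. \<Prod>i\<in>\<phi> p. x i) = (\<Sum>t\<in>triangles n. 6 * (\<Prod>i\<in>t. x i))"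
    by (subst sum_fun_comp[OF fin finite_triangles im]) simp
  moreover have "tri_sum n (adj x) (adj x) (adj x) =
      (\<Sum>(a, b, c)\<in>V. adj x (a, b) * adj x (b, c) * adj x (a, c))"
    by (simp add: tri_sum_def V_def sum.cartesian_product)
  moreover have "\<dots> = (\<Sum>p\<in>D. \<Prod>i\<in>\<phi> p. x i)"
    using DV finV by (intro sum.mono_neutral_cong_right)
      (auto simp: D_def V_def adj_def \<phi>_def doubleton_eq_iff insert_commute)
  ultimately show ?thesis by (simp add: sum_distrib_left)
qed

lemma card_edges: "2 * real (card (edges n)) = real n ^ 2 - real n"
proof -
  have "2 * real (card (edges n)) = (\<Sum>a<n. \<Sum>b<n. adj (\<lambda>_. 1) (a, b))"
    using sum_adj[of "\<lambda>_. 1" n] by (simp add: sum_vpairs)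
  also have "\<dots> = (\<Sum>a<n. \<Sum>b<n. 1 - (if a = b then 1 else 0))"
    by (intro sum.cong refl) (simp add: adj_def)
  also have "\<dots> = real n ^ 2 - real n"
    by (simp add: sum_subtractf power2_eq_square right_diff_distrib)
  finally show ?thesis .
qed

lemma card_triangles_ge: "6 * real (card (triangles n)) \<ge> real n ^ 3 - 3 * real n ^ 2"
proof -
  have ab: "(\<Sum>a<n. \<Sum>b<n. \<Sum>c<n. if a = b then 1 else 0 :: real) = real n ^ 2"
  proof -
    have "(\<Sum>c<n. if a = b then 1 else 0 :: real) = (if a = b then real n else 0)" for a b :: nat
      by simp
    then show ?thesis by (simp add: power2_eq_square)
  qed
  have bc: "(\<Sum>a<n. \<Sum>b<n. \<Sum>c<n. if b = c then 1 else 0 :: real) = real n ^ 2"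
    and ac: "(\<Sum>a<n. \<Sum>b<n. \<Sum>c<n. if a = c then 1 else 0 :: real) = real n ^ 2"
    by (simp_all add: power2_eq_square)
  have "real n ^ 3 - 3 * real n ^ 2 = (\<Sum>a<n. \<Sum>b<n. \<Sum>c<n.
      1 - (if a = b then 1 else 0) - (if b = c then 1 else 0) - (if a = c then 1 else 0))"
    unfolding sum_subtractf ab bc ac by (simp add: power3_eq_cube)
  also have "\<dots> \<le> tri_sum n (adj (\<lambda>_. 1)) (adj (\<lambda>_. 1)) (adj (\<lambda>_. 1))"
    unfolding tri_sum_def by (intro sum_mono) (simp add: adj_def)
  also have "\<dots> = 6 * real (card (triangles n))"
    unfolding sum_triangles[symmetric] by simp
  finally show ?thesis .
qed

section \<open>Independent edges and the entropy\<close>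

text \<open>
  The probability of the graph \<open>x\<close> when the edges \<open>e\<close> are present independently with
  probabilities \<open>d e\<close>.
\<close>

definition bernoulli_weight :: "nat \<Rightarrow> (nat set \<Rightarrow> real) \<Rightarrow> (nat set \<Rightarrow> real) \<Rightarrow> real" where
  "bernoulli_weight n d x = (\<Prod>e\<in>edges n. if x e = 1 then d e else 1 - d e)"

lemma bernoulli_weight_nonneg:
  "(\<And>e. e \<in> edges n \<Longrightarrow> d e \<in> {0..1}) \<Longrightarrow> bernoulli_weight n d x \<ge> 0"
  unfolding bernoulli_weight_def by (intro prod_nonneg) auto

lemma sum_bernoulli_weight_prod:
  assumes t: "t \<subseteq> edges n"
  shows "(\<Sum>x\<in>configs n. bernoulli_weight n d x * (\<Prod>i\<in>t. x i)) = (\<Prod>i\<in>t. d i)"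
proof -
  let ?f = "\<lambda>e v. (if v = 1 then d e else 1 - d e) * (if e \<in> t then v else 1 :: real)"
  have "(\<Sum>x\<in>configs n. bernoulli_weight n d x * (\<Prod>i\<in>t. x i)) =
      (\<Sum>x\<in>configs n. \<Prod>e\<in>edges n. ?f e (x e))"
  proof (intro sum.cong refl)
    fix x :: "nat set \<Rightarrow> real"
    have "(\<Prod>i\<in>t. x i) = (\<Prod>e\<in>edges n. if e \<in> t then x e else 1)"
      using t finite_edges[of n] by (simp add: prod.inter_restrict[symmetric] Int_absorb1)
    then show "bernoulli_weight n d x * (\<Prod>i\<in>t. x i) = (\<Prod>e\<in>edges n. ?f e (x e))"
      by (simp add: bernoulli_weight_def prod.distrib)
  qed
  also have "\<dots> = (\<Prod>e\<in>edges n. \<Sum>v\<in>{0, 1}. ?f e v)"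
    unfolding configs_def by (rule prod_sum_PiE[symmetric]) (simp_all add: finite_edges)
  also have "\<dots> = (\<Prod>e\<in>edges n. if e \<in> t then d e else 1)"
    by (intro prod.cong refl) simp
  also have "\<dots> = (\<Prod>i\<in>t. d i)"
    using t finite_edges[of n] by (simp add: prod.inter_restrict[symmetric] Int_absorb1)
  finally show ?thesis .
qed

lemma sum_bernoulli_weight: "(\<Sum>x\<in>configs n. bernoulli_weight n d x) = 1"
  using sum_bernoulli_weight_prod[of "{}" n d] by simp

lemma exp_weighted_sum_le:
  fixes w Y :: "'a \<Rightarrow> real"
  assumes "\<And>x. x \<in> A \<Longrightarrow> w x \<ge> 0" "(\<Sum>x\<in>A. w x) = 1"
  shows "exp (\<Sum>x\<in>A. w x * Y x) \<le> (\<Sum>x\<in>A. w x * exp (Y x))"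
proof -
  define m where "m = (\<Sum>x\<in>A. w x * Y x)"
  have "exp m = exp m * (\<Sum>x\<in>A. w x * (1 + (Y x - m)))"
    using assms by (simp add: distrib_left right_diff_distrib sum.distrib sum_subtractf
        m_def sum_distrib_right[symmetric])
  also have "\<dots> = (\<Sum>x\<in>A. w x * (exp m * (1 + (Y x - m))))"
    by (simp add: sum_distrib_left mult_ac)
  also have "\<dots> \<le> (\<Sum>x\<in>A. w x * exp (Y x))"
  proof (intro sum_mono mult_left_mono)
    fix x
    have "exp m * (1 + (Y x - m)) \<le> exp m * exp (Y x - m)"
      by (intro mult_left_mono exp_ge_add_one_self) auto
    then show "exp m * (1 + (Y x - m)) \<le> exp (Y x)" by (simp add: exp_diff)
  qed (use assms in auto)
  finally show ?thesis by (simp add: m_def)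
qed

text \<open>
  The Gibbs variational principle with independent edges of probability \<open>u\<close> as trial measure \<open>w\<close>:
  write the weight of a graph as at least \<open>w x * exp (H x - ln (w x))\<close> and apply Jensen's inequality.
  The exponent is the expected Hamiltonian plus the entropy of \<open>w\<close>.
\<close>

lemma partition_fun_ge:
  assumes u: "u \<in> {0..1}"
  shows "exp (\<alpha> / real n * (real (card (triangles n)) * u ^ 3)
      + real (card (edges n)) * (h * u - entropy_fun u)) \<le> partition_fun n \<alpha> h"
proof -
  let ?w = "bernoulli_weight n (\<lambda>_. u)"
  \<comment> \<open>\<open>\<Lambda>\<close> is the logarithm of the weight where the weight is positive. At \<open>u = 0\<close> and \<open>u = 1\<close> the
    value \<open>ln 0 = 0\<close> is harmless, since graphs of weight zero only need a lower bound of zero.\<close>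
  define \<Lambda> where "\<Lambda> = (\<lambda>x. \<Sum>e\<in>edges n. x e * ln u + (1 - x e) * ln (1 - u))"
  have edge: "(\<Sum>x\<in>configs n. ?w x * x e) = u" if "e \<in> edges n" for e
    using sum_bernoulli_weight_prod[of "{e}" n "\<lambda>_. u"] that by simp
  have S: "(\<Sum>x\<in>configs n. ?w x * (\<Sum>e\<in>edges n. a * x e + b)) = real (card (edges n)) * (a * u + b)" for a b
  proof -
    have "(\<Sum>x\<in>configs n. ?w x * (\<Sum>e\<in>edges n. a * x e + b)) =
        (\<Sum>e\<in>edges n. \<Sum>x\<in>configs n. a * (?w x * x e) + b * ?w x)"
      by (subst sum.swap) (simp add: sum_distrib_left algebra_simps)
    also have "\<dots> = (\<Sum>e\<in>edges n. a * u + b)"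
      by (intro sum.cong refl)
        (simp add: sum.distrib sum_distrib_left[symmetric] edge sum_bernoulli_weight)
    finally show ?thesis by simp
  qed
  have T: "(\<Sum>x\<in>configs n. ?w x * (\<Sum>t\<in>triangles n. \<Prod>i\<in>t. x i)) = real (card (triangles n)) * u ^ 3"
  proof -
    have "(\<Sum>x\<in>configs n. ?w x * (\<Sum>t\<in>triangles n. \<Prod>i\<in>t. x i)) =
        (\<Sum>t\<in>triangles n. \<Sum>x\<in>configs n. ?w x * (\<Prod>i\<in>t. x i))"
      by (subst sum.swap) (simp add: sum_distrib_left)
    also have "\<dots> = (\<Sum>t\<in>triangles n. u ^ 3)"
      by (intro sum.cong refl) (simp add: sum_bernoulli_weight_prod triangle_edges)
    finally show ?thesis by simp
  qed
  define Y where "Y = (\<lambda>x. hamiltonian n \<alpha> h x - \<Lambda> x)"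
  have Y: "Y x = \<alpha> / real n * (\<Sum>t\<in>triangles n. \<Prod>i\<in>t. x i)
      + (\<Sum>e\<in>edges n. (h - ln u + ln (1 - u)) * x e + - ln (1 - u))" for x
    unfolding Y_def hamiltonian_def \<Lambda>_def
    by (simp add: sum_distrib_left sum_subtractf[symmetric] sum.distrib[symmetric] algebra_simps)
  have "(\<Sum>x\<in>configs n. ?w x * Y x) =
      \<alpha> / real n * (\<Sum>x\<in>configs n. ?w x * (\<Sum>t\<in>triangles n. \<Prod>i\<in>t. x i))
      + (\<Sum>x\<in>configs n. ?w x * (\<Sum>e\<in>edges n. (h - ln u + ln (1 - u)) * x e + - ln (1 - u)))"
    unfolding Y distrib_left sum.distrib mult.left_commute[of "?w _" "\<alpha> / real n"]
    by (simp only: sum_distrib_left)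
  also have "\<dots> = \<alpha> / real n * (real (card (triangles n)) * u ^ 3)
      + real (card (edges n)) * (h * u - entropy_fun u)"
    unfolding S T by (simp add: entropy_fun_def algebra_simps)
  finally have mean: "(\<Sum>x\<in>configs n. ?w x * Y x) = \<dots>" .
  have "exp (\<Sum>x\<in>configs n. ?w x * Y x) \<le> (\<Sum>x\<in>configs n. ?w x * exp (Y x))"
    using u by (intro exp_weighted_sum_le bernoulli_weight_nonneg sum_bernoulli_weight)
  also have "\<dots> \<le> (\<Sum>x\<in>configs n. exp (hamiltonian n \<alpha> h x))"
  proof (intro sum_mono)
    fix x assume x: "x \<in> configs n"
    have "?w x * exp (- \<Lambda> x) =
        (\<Prod>e\<in>edges n. (if x e = 1 then u else 1 - u) * exp (- (x e * ln u + (1 - x e) * ln (1 - u))))"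
      by (simp add: \<Lambda>_def bernoulli_weight_def prod.distrib exp_sum finite_edges flip: sum_negf)
    also have "\<dots> \<le> 1"
    proof (intro prod_le_1 conjI)
      fix e assume "e \<in> edges n"
      then have "x e = 0 \<or> x e = 1" using x by (auto simp: configs_def PiE_def Pi_def)
      then show "(if x e = 1 then u else 1 - u) * exp (- (x e * ln u + (1 - x e) * ln (1 - u))) \<le> 1"
        using u by (cases "u = 0"; cases "u = 1") (auto simp: exp_minus)
    qed (use u in auto)
    finally have "(?w x * exp (- \<Lambda> x)) * exp (hamiltonian n \<alpha> h x) \<le> 1 * exp (hamiltonian n \<alpha> h x)"
      by (intro mult_right_mono) auto
    then show "?w x * exp (Y x) \<le> exp (hamiltonian n \<alpha> h x)"
      by (simp add: Y_def exp_diff exp_minus field_simps)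
  qed
  finally show ?thesis unfolding mean partition_fun_def .
qed

text \<open>
  Symmetry of \<open>X\<close> passes to its block averages, so these define probabilities for unordered pairs.
\<close>

lemma block_avg_sym:
  assumes "\<And>i j. X (i, j) = X (j, i)" "i < n" "j < n"
  shows "block_avg n c X (i, j) = block_avg n c X (j, i)"
proof -
  have "block_avg n c X (prod.swap (j, i)) = block_avg n c X (j, i)"
    using assms by (intro cell_avg_comp) (auto simp: product_swap inj_on_def)
  then show ?thesis by simp
qed

lemma adj_config:
  assumes "x \<in> configs n" "p \<in> vpairs n"
  shows "adj x p \<in> {0, 1}"
  using assms edge_in_edges[of "fst p" n "snd p"]
  by (auto simp: adj_def configs_def PiE_def Pi_def)

text \<open>
  The log-likelihood of \<open>x\<close> under the edge probabilities \<open>D\<close> is linear in \<open>x\<close> with coefficients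
  that are constant on blocks. Hence \<open>x\<close> may be replaced there by its block averages \<open>D\<close>, which turns
  the log-likelihood into \<open>(\<Sum>p. I(D p)) / 2\<close>. The diagonal is no edge, but it contributes to the
  block sums; it enters with \<open>ln (1 - D p) \<le> 0\<close>, which is the favourable sign.
\<close>

lemma exp_entropy_le_bernoulli_weight:
  fixes c :: "nat \<Rightarrow> nat"
  assumes x: "x \<in> configs n"
  defines "D \<equiv> block_avg n c (adj x)"
  shows "exp ((\<Sum>p\<in>vpairs n. entropy_fun (D p)) / 2)
    \<le> bernoulli_weight n (\<lambda>e. D (Min e, Max e)) x"
proof -
  let ?X = "adj x" and ?d = "\<lambda>e. D (Min e, Max e)"
  have fin: "finite (vpairs n)" by simp
  have X01: "p \<in> vpairs n \<Longrightarrow> ?X p \<in> {0..1}" for p using adj_config[OF x, of p] by auto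
  have D01: "D p \<in> {0..1}" for p
    unfolding D_def by (rule cell_avg_unit_interval[OF fin X01])
  define f where "f = (\<lambda>e. x e * ln (?d e) + (1 - x e) * ln (1 - ?d e))"
  have "(\<Sum>p\<in>vpairs n. D p * (ln (D p) - ln (1 - D p))) =
      (\<Sum>p\<in>vpairs n. ?X p * (ln (D p) - ln (1 - D p)))"
    unfolding D_def
  proof (rule cell_avg_inner[OF fin])
    fix p q assume "pair_label c p = pair_label c q"
    then have "block_avg n c ?X p = block_avg n c ?X q" by (rule cell_avg_cong)
    then show "ln (block_avg n c ?X p) - ln (1 - block_avg n c ?X p) =
        ln (block_avg n c ?X q) - ln (1 - block_avg n c ?X q)" by simp
  qed
  then have "(\<Sum>p\<in>vpairs n. entropy_fun (D p)) =
      (\<Sum>p\<in>vpairs n. ?X p * (ln (D p) - ln (1 - D p)) + ln (1 - D p))"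
    by (simp add: sum.distrib entropy_fun_def algebra_simps sum_subtractf)
  also have "\<dots> \<le> (\<Sum>p\<in>vpairs n. adj f p)"
  proof (intro sum_mono)
    fix p assume p: "p \<in> vpairs n"
    obtain i j where ij: "p = (i, j)" "i < n" "j < n" using p by auto
    have D: "D (min i j, max i j) = D (i, j)"
      using block_avg_sym[of ?X, OF adj_sym, of i n j c] ij by (simp add: D_def min_def max_def)
    show "?X p * (ln (D p) - ln (1 - D p)) + ln (1 - D p) \<le> adj f p"
    proof (cases "i = j")
      case True
      have "ln (1 - D p) \<le> 0" using D01[of p] by (cases "D p = 1") auto
      then show ?thesis using True ij by (simp add: adj_def)
    next
      case False
      then show ?thesis using ij D by (simp add: adj_def f_def algebra_simps)
    qed
  qed
  also have "\<dots> = 2 * (\<Sum>e\<in>edges n. f e)" by (rule sum_adj)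
  finally have "exp ((\<Sum>p\<in>vpairs n. entropy_fun (D p)) / 2) \<le> exp (\<Sum>e\<in>edges n. f e)" by simp
  also have "\<dots> = (\<Prod>e\<in>edges n. exp (f e))" by (rule exp_sum[OF finite_edges])
  also have "\<dots> \<le> (\<Prod>e\<in>edges n. if x e = 1 then ?d e else 1 - ?d e)"
  proof (intro prod_mono conjI)
    fix e assume e: "e \<in> edges n"
    obtain i j where ij: "e = {i, j}" "i < j" "j < n" "Min e = i" "Max e = j"
      using e by (rule edgesE)
    have p: "(i, j) \<in> vpairs n" and X: "?X (i, j) = x e" using ij by (auto simp: adj_def)
    have xe: "x e = 0 \<or> x e = 1" using adj_config[OF x p] X by auto
    \<comment> \<open>Averages \<open>0\<close> and \<open>1\<close> force the value of \<open>x\<close>, so a logarithm of zero only occurs with factor zero.\<close>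
    have "D (i, j) \<noteq> 0" if "x e = 1"
      using cell_avg_eq_0D[where P = "vpairs n" and X = ?X and \<kappa> = "pair_label c",
          OF fin X01 p] that X by (auto simp: D_def)
    moreover have "D (i, j) \<noteq> 1" if "x e = 0"
      using cell_avg_eq_1D[where P = "vpairs n" and X = ?X and \<kappa> = "pair_label c",
          OF fin X01 p] that X by (auto simp: D_def)
    ultimately show "exp (f e) \<le> (if x e = 1 then ?d e else 1 - ?d e)"
      using xe D01[of "(i, j)"] ij by (auto simp: f_def)
  qed simp
  finally show ?thesis by (simp add: bernoulli_weight_def)
qed

section \<open>Exponential bounds for the Gibbs weights\<close>

text \<open>
  A union bound over types: if, within each type \<open>g x\<close>, the terms are dominated by \<open>C\<close> times a
  subprobability that depends only on the type, then each type contributes at most \<open>C\<close>.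
\<close>

lemma sum_le_card_image_mult:
  fixes f :: "'a \<Rightarrow> real" and w :: "'b \<Rightarrow> 'a \<Rightarrow> real"
  assumes A: "finite A" "B \<subseteq> A"
    and f: "\<And>x. x \<in> B \<Longrightarrow> f x \<le> C * w (g x) x" and C: "C \<ge> 0"
    and w: "\<And>x y. x \<in> B \<Longrightarrow> y \<in> A \<Longrightarrow> 0 \<le> w (g x) y"
    and w1: "\<And>x. x \<in> B \<Longrightarrow> (\<Sum>y\<in>A. w (g x) y) \<le> 1"
  shows "(\<Sum>x\<in>B. f x) \<le> real (card (g ` B)) * C"
proof -
  have B: "finite B" using A finite_subset by blast
  have "(\<Sum>x\<in>B. f x) = (\<Sum>t\<in>g ` B. \<Sum>x | x \<in> B \<and> g x = t. f x)"
    by (rule sum.image_gen[OF B])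
  also have "\<dots> \<le> (\<Sum>t\<in>g ` B. C)"
  proof (intro sum_mono)
    fix t assume "t \<in> g ` B"
    then obtain x0 where x0: "x0 \<in> B" "t = g x0" by blast
    have "(\<Sum>x | x \<in> B \<and> g x = t. f x) \<le> (\<Sum>x | x \<in> B \<and> g x = t. C * w t x)"
      using f by (intro sum_mono) auto
    also have "\<dots> \<le> (\<Sum>y\<in>A. C * w t y)"
      using A C w[OF x0(1)] x0(2) by (intro sum_mono2) auto
    also have "\<dots> \<le> C"
      using mult_left_mono[OF w1[OF x0(1)] C] x0(2) by (simp add: sum_distrib_left[symmetric])
    finally show "(\<Sum>x | x \<in> B \<and> g x = t. f x) \<le> C" .
  qed
  finally show ?thesis by simp
qed

text \<open>
  Restricted to the edges, so that equal block densities give equal profiles and profiles can be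
  counted.
\<close>

definition edge_profile :: "nat \<Rightarrow> (nat \<Rightarrow> nat) \<Rightarrow> (nat set \<Rightarrow> real) \<Rightarrow> nat set \<Rightarrow> real" where
  "edge_profile n c x = (\<lambda>e\<in>edges n. block_avg n c (adj x) (Min e, Max e))"

text \<open>
  A profile is determined by the labels of the \<open>n\<close> vertices and, for each pair of labels, by the
  number of adjacent pairs of vertices with these labels, which is at most \<open>n\<^sup>2\<close>.
\<close>

lemma card_edge_profiles:
  assumes B: "B \<subseteq> configs n" and c: "\<And>x i. x \<in> B \<Longrightarrow> c x i < L"
  shows "card ((\<lambda>x. edge_profile n (c x) x) ` B) \<le> L ^ n * (n\<^sup>2 + 1) ^ (L\<^sup>2)"
proof -
  define Lab where "Lab = ({..<n} \<rightarrow>\<^sub>E {..<L})"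
  define Cnt where "Cnt = (({..<L} \<times> {..<L}) \<rightarrow>\<^sub>E {0..n\<^sup>2})"
  define F where "F = (\<lambda>(c', \<beta>). \<lambda>e\<in>edges n. real (\<beta> (pair_label c' (Min e, Max e))) /
    real (card {q \<in> vpairs n. pair_label c' q = pair_label c' (Min e, Max e)}))"
  have "(\<lambda>x. edge_profile n (c x) x) ` B \<subseteq> F ` (Lab \<times> Cnt)"
  proof (rule image_subsetI)
    fix x assume x: "x \<in> B"
    define c' where "c' = restrict (c x) {..<n}"
    define \<beta> where "\<beta> = (\<lambda>l\<in>{..<L} \<times> {..<L}.
      card {q \<in> vpairs n. pair_label (c x) q = l \<and> adj x q = 1})"
    have c': "c' \<in> Lab" using c[OF x] by (auto simp: c'_def Lab_def)
    have lab: "pair_label c' q = pair_label (c x) q" if "q \<in> vpairs n" for q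
      using that by (auto simp: c'_def)
    have "card {q \<in> vpairs n. pair_label (c x) q = l \<and> adj x q = 1} \<le> n\<^sup>2" for l
      using card_mono[of "vpairs n" "{q \<in> vpairs n. pair_label (c x) q = l \<and> adj x q = 1}"]
      by (auto simp: power2_eq_square)
    then have \<beta>: "\<beta> \<in> Cnt" by (auto simp: \<beta>_def Cnt_def)
    have "edge_profile n (c x) x = F (c', \<beta>)"
      unfolding edge_profile_def F_def prod.case
    proof (rule restrict_ext)
      fix e assume "e \<in> edges n"
      then obtain i j where e: "e = {i, j}" "i < j" "j < n" "Min e = i" "Max e = j" by (rule edgesE)
      let ?p = "(Min e, Max e)"
      have p: "?p \<in> vpairs n" using e by simp
      have cell: "{q \<in> vpairs n. pair_label c' q = pair_label c' ?p} =
          {q \<in> vpairs n. pair_label (c x) q = pair_label (c x) ?p}"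
        using lab lab[OF p] by auto
      have "(\<Sum>q | q \<in> vpairs n \<and> pair_label (c x) q = pair_label (c x) ?p. adj x q) =
          (\<Sum>q | q \<in> vpairs n \<and> pair_label (c x) q = pair_label (c x) ?p \<and> adj x q = 1. 1)"
        using adj_config[of x n] x B
        by (intro sum.mono_neutral_cong_right) (auto intro: finite_subset[of _ "vpairs n"])
      also have "\<dots> = real (\<beta> (pair_label c' ?p))"
        using c[OF x] lab[OF p] by (simp add: \<beta>_def)
      finally show "block_avg n (c x) (adj x) ?p = real (\<beta> (pair_label c' ?p)) /
          real (card {q \<in> vpairs n. pair_label c' q = pair_label c' ?p})"
        unfolding cell by (simp only: cell_avg_def)
    qed
    then show "edge_profile n (c x) x \<in> F ` (Lab \<times> Cnt)" using c' \<beta> by blast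
  qed
  moreover have fin: "finite (Lab \<times> Cnt)"
    by (auto simp: Lab_def Cnt_def intro!: finite_PiE)
  ultimately have "card ((\<lambda>x. edge_profile n (c x) x) ` B) \<le> card (F ` (Lab \<times> Cnt))"
    by (intro card_mono) auto
  also have "\<dots> \<le> card (Lab \<times> Cnt)" using fin by (rule card_image_le)
  also have "\<dots> = L ^ n * (n\<^sup>2 + 1) ^ (L\<^sup>2)"
    by (simp add: Lab_def Cnt_def card_cartesian_product card_PiE power2_eq_square)
  finally show ?thesis .
qed

text \<open>
  The Hamiltonian is at most the mean-field value of the block averages times \<open>n\<^sup>2\<close>, plus half of the
  entropy sum and the regularity error; the entropy sum is absorbed by the probability of \<open>x\<close> under its own edge profile.
\<close>

lemma exp_hamiltonian_le_bernoulli_weight: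
  fixes c :: "nat \<Rightarrow> nat"
  assumes x: "x \<in> configs n" and n: "n > 0" and \<alpha>: "\<alpha> \<ge> 0"
  defines "D \<equiv> block_avg n c (adj x)"
  assumes tri: "tri_sum n (adj x) (adj x) (adj x) \<le> tri_sum n D D D + 2 * \<epsilon> * real n ^ 3"
    and gap: "\<alpha> / 6 * sqrt ((\<Sum>p\<in>vpairs n. (D p)\<^sup>2) / real (card (vpairs n))) ^ 3
      + (\<Sum>p\<in>vpairs n. h / 2 * D p - entropy_fun (D p) / 2) / real (card (vpairs n)) \<le> m"
  shows "exp (hamiltonian n \<alpha> h x)
    \<le> exp (real n ^ 2 * (m + \<alpha> * \<epsilon> / 3)) * bernoulli_weight n (edge_profile n c x) x"
proof -
  define s where "s = sqrt ((\<Sum>p\<in>vpairs n. (D p)\<^sup>2) / real (card (vpairs n)))"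
  define I where "I = (\<Sum>p\<in>vpairs n. entropy_fun (D p))"
  define S where "S = (\<Sum>e\<in>edges n. x e)"
  define V where "V = (\<Sum>t\<in>triangles n. \<Prod>i\<in>t. x i)"
  have s: "s * real n = sqrt (\<Sum>p\<in>vpairs n. (D p)\<^sup>2)"
    using n by (simp add: s_def real_sqrt_divide)
  have SD: "(\<Sum>p\<in>vpairs n. D p) = 2 * S"
    unfolding D_def S_def by (simp add: cell_avg_sum sum_adj)
  have lin: "(\<Sum>p\<in>vpairs n. h / 2 * D p - entropy_fun (D p) / 2) = h * S - I / 2"
    by (simp add: sum_subtractf I_def SD flip: sum_distrib_left sum_divide_distrib)
  have "\<alpha> / 6 * s ^ 3 + (h * S - I / 2) / real n ^ 2 \<le> m"
    using gap unfolding lin s_def[symmetric] by (simp add: power2_eq_square)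
  then have "real n ^ 2 * (\<alpha> / 6 * s ^ 3 + (h * S - I / 2) / real n ^ 2) \<le> real n ^ 2 * m"
    by (intro mult_left_mono) auto
  then have 1: "\<alpha> / 6 * s ^ 3 * real n ^ 2 + h * S - I / 2 \<le> real n ^ 2 * m"
    using n by (simp add: distrib_left mult_ac)
  have "6 * V \<le> (s * real n) ^ 3 + 2 * \<epsilon> * real n ^ 3"
    using tri tri_sum_le_Frobenius[of n D] unfolding V_def sum_triangles s by linarith
  then have "\<alpha> / (6 * real n) * (6 * V) \<le> \<alpha> / (6 * real n) * ((s * real n) ^ 3 + 2 * \<epsilon> * real n ^ 3)"
    using \<alpha> by (intro mult_left_mono) auto
  also have "\<dots> = \<alpha> / 6 * s ^ 3 * real n ^ 2 + real n ^ 2 * (\<alpha> * \<epsilon> / 3)"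
    using n by (simp add: power2_eq_square power3_eq_cube field_simps)
  finally have "\<alpha> / real n * V \<le> \<alpha> / 6 * s ^ 3 * real n ^ 2 + real n ^ 2 * (\<alpha> * \<epsilon> / 3)"
    by simp
  then have "hamiltonian n \<alpha> h x \<le> real n ^ 2 * (m + \<alpha> * \<epsilon> / 3) + I / 2"
    using 1 by (simp add: hamiltonian_def V_def S_def distrib_left)
  then have "exp (hamiltonian n \<alpha> h x) \<le> exp (real n ^ 2 * (m + \<alpha> * \<epsilon> / 3)) * exp (I / 2)"
    by (simp flip: exp_add)
  also have "exp (I / 2) \<le> bernoulli_weight n (edge_profile n c x) x"
  proof -
    have "bernoulli_weight n (edge_profile n c x) x = bernoulli_weight n (\<lambda>e. D (Min e, Max e)) x"
      unfolding bernoulli_weight_def by (intro prod.cong refl) (simp add: edge_profile_def D_def)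
    then show ?thesis
      using exp_entropy_le_bernoulli_weight[OF x, of c] by (simp add: I_def D_def)
  qed
  finally show ?thesis by simp
qed

text \<open>
  The large deviation upper bound. The hypothesis on \<open>B\<close> bounds the mean-field value of every matrix
  with entries in the unit interval and the same sum as the adjacency matrix; the block averages are
  such a matrix. The factor in front of the exponential bounds the number of edge profiles; it is \<open>exp (o(n\<^sup>2))\<close> since
  \<open>L\<close> does not depend on \<open>n\<close>.
\<close>

lemma restricted_partition_fun_le:
  assumes \<alpha>: "\<alpha> > 0" and \<delta>: "\<delta> > 0"
  shows "\<exists>L>0. \<forall>n>0. \<forall>B\<subseteq>configs n.
    (\<forall>x\<in>B. \<forall>D. (\<forall>p\<in>vpairs n. D p \<in> {0..1}) \<longrightarrow> (\<Sum>p\<in>vpairs n. D p) = 2 * edge_count n x \<longrightarrow>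
      \<alpha> / 6 * sqrt ((\<Sum>p\<in>vpairs n. (D p)\<^sup>2) / real (card (vpairs n))) ^ 3
      + (\<Sum>p\<in>vpairs n. h / 2 * D p - entropy_fun (D p) / 2) / real (card (vpairs n)) \<le> m) \<longrightarrow>
    (\<Sum>x\<in>B. exp (hamiltonian n \<alpha> h x))
      \<le> real (L ^ n * (n\<^sup>2 + 1) ^ (L\<^sup>2)) * exp (real n ^ 2 * (m + \<delta>))"
proof -
  \<comment> \<open>The regularity error \<open>2 \<epsilon> n\<^sup>3\<close> of the triangle sum costs \<open>\<alpha> \<epsilon> n\<^sup>2 / 3\<close> in the exponent.\<close>
  define \<epsilon> where "\<epsilon> = 3 * \<delta> / \<alpha>"
  have \<epsilon>: "\<epsilon> > 0" "\<alpha> * \<epsilon> / 3 = \<delta>" using \<alpha> \<delta> by (auto simp: \<epsilon>_def)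
  obtain N :: nat where "1 / \<epsilon>\<^sup>2 < real N" using reals_Archimedean2 by blast
  then have N: "real N * \<epsilon>\<^sup>2 > 1" using \<epsilon> by (simp add: field_simps)
  show ?thesis
  proof (intro exI[of _ "2 ^ N"] conjI allI impI)
    fix n :: nat and B
    assume n: "n > 0" and B: "B \<subseteq> configs n"
    assume gap: "\<forall>x\<in>B. \<forall>D. (\<forall>p\<in>vpairs n. D p \<in> {0..1}) \<longrightarrow>
      (\<Sum>p\<in>vpairs n. D p) = 2 * edge_count n x \<longrightarrow>
      \<alpha> / 6 * sqrt ((\<Sum>p\<in>vpairs n. (D p)\<^sup>2) / real (card (vpairs n))) ^ 3
      + (\<Sum>p\<in>vpairs n. h / 2 * D p - entropy_fun (D p) / 2) / real (card (vpairs n)) \<le> m"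
    have D01: "block_avg n c (adj x) p \<in> {0..1}" if "x \<in> B" for x c p
    proof (rule cell_avg_unit_interval)
      show "adj x q \<in> {0..1}" if "q \<in> vpairs n" for q
        using adj_config[OF subsetD[OF B \<open>x \<in> B\<close>] that] by auto
    qed simp
    have "\<exists>c. (\<forall>i. c i < 2 ^ N) \<and> tri_sum n (adj x) (adj x) (adj x) \<le>
        tri_sum n (block_avg n c (adj x)) (block_avg n c (adj x)) (block_avg n c (adj x))
        + 2 * \<epsilon> * real n ^ 3" if x: "x \<in> B" for x
    proof -
      have X: "adj x p \<in> {0, 1}" if "p \<in> vpairs n" for p
        using adj_config[OF subsetD[OF B x] that] .
      have "\<exists>c. (\<forall>i. c i < 2 ^ N) \<and> (\<forall>k<n. energy n (refine_by (adj x) k c) (adj x)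
          \<le> energy n c (adj x) + \<epsilon>\<^sup>2 * real (card (vpairs n)))"
        by (rule exists_saturated_labelling[OF _ \<epsilon>(1) N n]) (fact X)
      then obtain c where c: "\<forall>i. c i < 2 ^ N"
        and sat: "\<And>k. k < n \<Longrightarrow> energy n (refine_by (adj x) k c) (adj x)
          \<le> energy n c (adj x) + \<epsilon>\<^sup>2 * real (card (vpairs n))" by blast
      have "tri_sum n (adj x) (adj x) (adj x) \<le>
          tri_sum n (block_avg n c (adj x)) (block_avg n c (adj x)) (block_avg n c (adj x))
          + 2 * \<epsilon> * real n ^ 3"
        by (rule tri_sum_le_block_avg[where X = "adj x", OF _ adj_sym \<epsilon>(1)]) (fact X, fact sat)
      with c show ?thesis by blast
    qed
    then obtain c where c: "\<And>x i. x \<in> B \<Longrightarrow> c x i < 2 ^ N"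
      and tri: "\<And>x. x \<in> B \<Longrightarrow> tri_sum n (adj x) (adj x) (adj x) \<le>
        tri_sum n (block_avg n (c x) (adj x)) (block_avg n (c x) (adj x)) (block_avg n (c x) (adj x))
        + 2 * \<epsilon> * real n ^ 3"
      by metis
    have "(\<Sum>x\<in>B. exp (hamiltonian n \<alpha> h x)) \<le>
        real (card ((\<lambda>x. edge_profile n (c x) x) ` B)) * exp (real n ^ 2 * (m + \<delta>))"
    proof (rule sum_le_card_image_mult[where w = "bernoulli_weight n", OF finite_configs B])
      fix x assume x: "x \<in> B"
      have "(\<Sum>p\<in>vpairs n. block_avg n (c x) (adj x) p) = 2 * edge_count n x"
        by (simp add: cell_avg_sum sum_adj edge_count_def)
      then show "exp (hamiltonian n \<alpha> h x) \<le>
          exp (real n ^ 2 * (m + \<delta>)) * bernoulli_weight n (edge_profile n (c x) x) x"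
        using exp_hamiltonian_le_bernoulli_weight[of x n \<alpha> "c x" \<epsilon> h m] x B n \<alpha> tri[OF x] gap D01[OF x]
        by (auto simp: \<epsilon>(2))
      show "bernoulli_weight n (edge_profile n (c x) x) y \<ge> 0" for y
        using D01[OF x] by (intro bernoulli_weight_nonneg) (simp add: edge_profile_def)
    qed (simp_all add: sum_bernoulli_weight)
    also have "\<dots> \<le> real ((2 ^ N) ^ n * (n\<^sup>2 + 1) ^ ((2 ^ N)\<^sup>2)) * exp (real n ^ 2 * (m + \<delta>))"
      using card_edge_profiles[OF B, of c "2 ^ N"] c by (intro mult_right_mono of_nat_mono) auto
    finally show "(\<Sum>x\<in>B. exp (hamiltonian n \<alpha> h x)) \<le> \<dots>" .
  qed simp
qed

text \<open>
  The deviations of \<open>card (edges n)\<close> from \<open>n\<^sup>2 / 2\<close> and of \<open>card (triangles n)\<close> from \<open>n\<^sup>3 / 6\<close>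
  cost only a term linear in \<open>n\<close> in the exponent.
\<close>

lemma partition_fun_asymp_ge:
  assumes \<alpha>: "\<alpha> \<ge> 0" and u: "u \<in> {0..1}" and \<delta>: "\<delta> > 0"
  shows "\<forall>\<^sub>F n in sequentially.
    exp (real n ^ 2 * (scalar_functional \<alpha> h u - \<delta>)) \<le> partition_fun n \<alpha> h"
proof -
  define b where "b = \<alpha> / 2 * u ^ 3 + (h * u - entropy_fun u) / 2"
  have "((\<lambda>n. b / real n) \<longlongrightarrow> 0) sequentially" by real_asymp
  then have "\<forall>\<^sub>F n in sequentially. b / real n < \<delta>" using \<delta> by (rule order_tendstoD)
  then show ?thesis
    using eventually_gt_at_top[of 0]
  proof eventually_elim
    case (elim n)
    have *: "\<alpha> * u ^ 3 / (6 * real n) * (real n ^ 3 - 3 * real n ^ 2)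
        \<le> \<alpha> * u ^ 3 / (6 * real n) * (6 * real (card (triangles n)))"
      using \<alpha> u by (intro mult_left_mono card_triangles_ge) auto
    then have T: "\<alpha> / 6 * u ^ 3 * real n ^ 2 - \<alpha> / 2 * u ^ 3 * real n
        \<le> \<alpha> / real n * (real (card (triangles n)) * u ^ 3)"
    proof -
      have "\<alpha> * u ^ 3 / (6 * real n) * (real n ^ 3 - 3 * real n ^ 2) =
          \<alpha> / 6 * u ^ 3 * real n ^ 2 - \<alpha> / 2 * u ^ 3 * real n"
        using elim by (simp add: power2_eq_square power3_eq_cube field_simps)
      moreover have "\<alpha> * u ^ 3 / (6 * real n) * (6 * real (card (triangles n))) =
          \<alpha> / real n * (real (card (triangles n)) * u ^ 3)" by simp
      ultimately show ?thesis using * by linarith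
    qed
    have E: "real (card (edges n)) = (real n ^ 2 - real n) / 2" using card_edges[of n] by simp
    have "b < \<delta> * real n" using elim by (simp add: field_simps)
    then have "b * real n \<le> \<delta> * real n * real n" by (intro mult_right_mono) auto
    then have "real n ^ 2 * (scalar_functional \<alpha> h u - \<delta>) \<le>
        \<alpha> / 6 * u ^ 3 * real n ^ 2 - \<alpha> / 2 * u ^ 3 * real n
        + (real n ^ 2 - real n) / 2 * (h * u - entropy_fun u)"
      by (simp add: scalar_functional_def b_def power2_eq_square field_simps)
    also have "\<dots> \<le> \<alpha> / real n * (real (card (triangles n)) * u ^ 3)
        + real (card (edges n)) * (h * u - entropy_fun u)"
      using T unfolding E by linarith
    finally have "exp (real n ^ 2 * (scalar_functional \<alpha> h u - \<delta>)) \<le>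
        exp (\<alpha> / real n * (real (card (triangles n)) * u ^ 3)
          + real (card (edges n)) * (h * u - entropy_fun u))" by simp
    also note partition_fun_ge[OF u]
    finally show ?case .
  qed
qed

lemma prob_gibbs_complement:
  "\<P>(x in gibbs n \<alpha> h. Q x) =
    1 - (\<Sum>x | x \<in> configs n \<and> \<not> Q x. exp (hamiltonian n \<alpha> h x)) / partition_fun n \<alpha> h"
proof -
  interpret prob_space "gibbs n \<alpha> h" by (rule prob_space_gibbs)
  have space: "space (gibbs n \<alpha> h) = configs n" by (simp add: gibbs_def space_point_measure)
  have sets: "A \<in> sets (gibbs n \<alpha> h)" if "A \<subseteq> configs n" for A
    using that by (simp add: gibbs_def sets_point_measure)
  have "partition_fun n \<alpha> h \<ge> 0" unfolding partition_fun_def by (intro sum_nonneg) auto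
  then have "\<P>(x in gibbs n \<alpha> h. \<not> Q x) =
      (\<Sum>x | x \<in> configs n \<and> \<not> Q x. exp (hamiltonian n \<alpha> h x) / partition_fun n \<alpha> h)"
    unfolding space by (simp add: gibbs_def measure_point_measure_finite_if finite_configs)
  then show ?thesis
    using prob_neg[of "\<lambda>x. \<not> Q x"] by (simp add: space sets sum_divide_distrib)
qed

section \<open>Concentration of the edge density\<close>

theorem theorem3p3:
  fixes \<alpha> h u1 u2 :: real
  assumes "(\<alpha>, h) \<in> M_rs"
    and "maximizers \<alpha> h = {u1, u2}" and "u1 \<noteq> u2"
  shows "\<forall>\<^sub>F \<epsilon> in at_right 0. \<exists>k>0. \<forall>\<^sub>F n in sequentially.
           \<P>(x in gibbs n \<alpha> h. 2 * edge_count n x / (real n)\<^sup>2 \<in> J_set u1 u2 \<epsilon>)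
             \<ge> 1 - exp (- k * (real n)\<^sup>2)"
  using eventually_at_right_less[of "0::real"]
proof eventually_elim
  case (elim \<epsilon>)
  have \<alpha>: "\<alpha> > 0" using assms(1) by (simp add: M_rs_def alpha_c_def)
  define M where "M = scalar_functional \<alpha> h u1"
  have u1: "u1 \<in> {0..1}" using assms(2) maximizers_iff[of u1 \<alpha> h] by blast
  obtain k where k: "k > 0"
    and gap: "\<And>P d. finite P \<Longrightarrow> P \<noteq> {} \<Longrightarrow> (\<forall>p\<in>P. d p \<in> {0..1}) \<Longrightarrow>
      (\<Sum>p\<in>P. d p) / real (card P) \<notin> J_set u1 u2 \<epsilon> \<Longrightarrow>
      \<alpha> / 6 * sqrt ((\<Sum>p\<in>P. (d p)\<^sup>2) / real (card P)) ^ 3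
        + (\<Sum>p\<in>(P :: (nat \<times> nat) set). h / 2 * d p - entropy_fun (d p) / 2) / real (card P)
      \<le> M - k"
    using mean_field_gap_outside_J[OF \<alpha> assms(2,3) elim, where 'a = "nat \<times> nat"]
    unfolding M_def by meson
  define bad where "bad = (\<lambda>n. {x \<in> configs n. 2 * edge_count n x / (real n)\<^sup>2 \<notin> J_set u1 u2 \<epsilon>})"
  \<comment> \<open>The gap \<open>k\<close> is split in four: regularity, the number of profiles and the lower bound of the
    partition function take a quarter each, and the last quarter is the rate.\<close>
  have k4: "k / 4 > 0" using k by simp
  obtain L where L: "L > 0" and upper: "\<And>n B. n > 0 \<Longrightarrow> B \<subseteq> configs n \<Longrightarrow>
    (\<forall>x\<in>B. \<forall>D. (\<forall>p\<in>vpairs n. D p \<in> {0..1}) \<longrightarrow> (\<Sum>p\<in>vpairs n. D p) = 2 * edge_count n x \<longrightarrow>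
      \<alpha> / 6 * sqrt ((\<Sum>p\<in>vpairs n. (D p)\<^sup>2) / real (card (vpairs n))) ^ 3
      + (\<Sum>p\<in>vpairs n. h / 2 * D p - entropy_fun (D p) / 2) / real (card (vpairs n)) \<le> M - k) \<Longrightarrow>
    (\<Sum>x\<in>B. exp (hamiltonian n \<alpha> h x))
      \<le> real (L ^ n * (n\<^sup>2 + 1) ^ (L\<^sup>2)) * exp (real n ^ 2 * (M - k + k / 4))"
    using restricted_partition_fun_le[OF \<alpha> k4, of h "M - k"] by meson
  have poly: "\<forall>\<^sub>F n in sequentially. real (L ^ n * (n\<^sup>2 + 1) ^ (L\<^sup>2)) \<le> exp (real n ^ 2 * (k / 4))"
  proof -
    define a b where "a = ln (real L)" and "b = real (L\<^sup>2)"
    have "((\<lambda>n. (real n * a + b * ln (real n ^ 2 + 1)) / real n ^ 2) \<longlongrightarrow> 0) sequentially"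
      by real_asymp
    then have "\<forall>\<^sub>F n in sequentially. (real n * a + b * ln (real n ^ 2 + 1)) / real n ^ 2 < k / 4"
      using k4 by (rule order_tendstoD)
    then show ?thesis
      using eventually_gt_at_top[of 0]
    proof eventually_elim
      case (elim n)
      have pos: "real n ^ 2 + 1 > 0" by (intro add_nonneg_pos) auto
      have "exp (real n * a) = real L ^ n"
        unfolding a_def exp_of_nat_mult using L by simp
      moreover have "exp (b * ln (real n ^ 2 + 1)) = (real n ^ 2 + 1) ^ (L\<^sup>2)"
        unfolding b_def exp_of_nat_mult using pos by simp
      ultimately have "real (L ^ n * (n\<^sup>2 + 1) ^ (L\<^sup>2)) = exp (real n * a + b * ln (real n ^ 2 + 1))"
        unfolding exp_add of_nat_mult of_nat_power of_nat_add of_nat_1 by simp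
      also have "\<dots> \<le> exp (real n ^ 2 * (k / 4))"
        using elim by (simp add: field_simps)
      finally show ?case .
    qed
  qed
  show ?case
  proof (intro exI[of _ "k / 4"] conjI k4)
    show "\<forall>\<^sub>F n in sequentially.
        1 - exp (- (k / 4) * (real n)\<^sup>2)
          \<le> \<P>(x in gibbs n \<alpha> h. 2 * edge_count n x / (real n)\<^sup>2 \<in> J_set u1 u2 \<epsilon>)"
      using poly partition_fun_asymp_ge[OF less_imp_le[OF \<alpha>] u1 k4, of h] eventually_gt_at_top[of 0]
    proof eventually_elim
      case (elim n)
      let ?Z = "partition_fun n \<alpha> h" and ?N = "(real n)\<^sup>2"
      have card: "real (card (vpairs n)) = (real n)\<^sup>2" by (simp add: power2_eq_square)
      have "(\<Sum>x\<in>bad n. exp (hamiltonian n \<alpha> h x))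
          \<le> real (L ^ n * (n\<^sup>2 + 1) ^ (L\<^sup>2)) * exp (?N * (M - k + k / 4))"
      proof (rule upper[OF elim(3)], safe)
        fix x D
        assume x: "x \<in> bad n" and D: "\<forall>p\<in>vpairs n. D p \<in> {0..1::real}"
          and sum: "(\<Sum>p\<in>vpairs n. D p) = 2 * edge_count n x"
        show "\<alpha> / 6 * sqrt ((\<Sum>p\<in>vpairs n. (D p)\<^sup>2) / real (card (vpairs n))) ^ 3
          + (\<Sum>p\<in>vpairs n. h / 2 * D p - entropy_fun (D p) / 2) / real (card (vpairs n)) \<le> M - k"
        proof (rule gap)
          show "(\<Sum>p\<in>vpairs n. D p) / real (card (vpairs n)) \<notin> J_set u1 u2 \<epsilon>"
            using x unfolding sum card by (simp add: bad_def)
        qed (use D elim(3) in auto)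
      qed (auto simp: bad_def)
      also have "\<dots> \<le> exp (?N * (k / 4)) * exp (?N * (M - k + k / 4))"
        using elim(1) by (intro mult_right_mono) auto
      also have "\<dots> = exp (- (k / 4) * ?N) * exp (?N * (M - k / 4))"
        by (simp flip: exp_add add: algebra_simps)
      also have "\<dots> \<le> exp (- (k / 4) * ?N) * ?Z"
        using elim(2) by (intro mult_left_mono) (auto simp: M_def)
      finally have "(\<Sum>x\<in>bad n. exp (hamiltonian n \<alpha> h x)) / ?Z \<le> exp (- (k / 4) * ?N)"
        using order_less_le_trans[OF exp_gt_zero elim(2)] by (simp add: pos_divide_le_eq)
      then show ?case unfolding prob_gibbs_complement by (simp add: bad_def)
    qed
  qed
qed

end
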